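(* Let $0<q<1$, $c>0$ and $\alpha>-1$. For all $k,l\in\mathbb{Z}$, $$\delta_{k,l}\,c\,q^{-k}(-cq^k;q)_\infty\,\frac{(-cq^{\alpha+1},-q^{-\alpha}/c;q)_\infty}{(-c,-q/c;q)_\infty}$$ $$=\frac{c^{\frac12-\alpha}}{q^k-q^l}\Bigl(q^{\frac12k}J^{(2)}_{\alpha+1}(2\sqrt{c}\,q^{\frac12k};q)\,J^{(2)}_{\alpha}(2\sqrt{c}\,q^{\frac12l};q)-q^{\frac12l}J^{(2)}_{\alpha+1}(2\sqrt{c}\,q^{\frac12l};q)\,J^{(2)}_{\alpha}(2\sqrt{c}\,q^{\frac12k};q)\Bigr)$$ $$+\,q^{\alpha(\frac12(k+l)-1)}\sum_{p=-\infty}^\infty q^p\,\frac{(-q^{p+1-\alpha}/c;q)_\infty}{(-q^{p+1}/c;q)_\infty}\,\frac{(q^{\alpha+1};q)_\infty}{(q;q)_\infty}\,{}_1\varphi_1\left({-cq^{\alpha-p}\atop q^{\alpha+1}};q,q^{k+p+1}\right)\frac{(q^{\alpha+1};q)_\infty}{(q;q)_\infty}\,{}_1\varphi_1\left({-cq^{\alpha-p}\atop q^{\alpha+1}};q,q^{l+p+1}\right),$$ where for $k=l$ the first term on the right-hand side (the one with the factor $1/(q^k-q^l)$) is understood as its limit by l'Hôpital's rule, i.e. as the limit $l\to k$ through real values $l\ne k$.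
   Context: Notation: $(a;q)_n=\prod_{i=0}^{n-1}(1-aq^i)$, $(a;q)_\infty=\prod_{i\ge0}(1-aq^i)$, $(a_1,\dots,a_m;q)_n=\prod_j (a_j;q)_n$ for $n\in\mathbb{Z}_{\ge0}\cup\{\infty\}$, and $${}_1\varphi_1\left({a\atop b};q,z\right)=\sum_{j=0}^\infty\frac{(a;q)_j}{(b;q)_j(q;q)_j}(-1)^jq^{j(j-1)/2}z^j,\qquad {}_0\varphi_1\left({-\atop b};q,z\right)=\sum_{j=0}^\infty\frac{q^{j(j-1)}z^j}{(b;q)_j(q;q)_j}.$$ Jackson's (second) $q$-Bessel function is, for $x>0$, $$J^{(2)}_\alpha(x;q)=\frac{(q^{\alpha+1};q)_\infty}{(q;q)_\infty}\left(\frac x2\right)^\alpha{}_0\varphi_1\left({-\atop q^{\alpha+1}};q,-q^{\alpha+1}\frac{x^2}{4}\right).$$ *)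

theory Defs
  imports "HOL-Analysis.Analysis"
begin

definition qpoch :: "real \<Rightarrow> real \<Rightarrow> nat \<Rightarrow> real" where
  "qpoch a q n = (\<Prod>i<n. 1 - a * q ^ i)"

definition qpoch_inf :: "real \<Rightarrow> real \<Rightarrow> real" where
  "qpoch_inf a q = (\<Prod>i. 1 - a * q ^ i)"

definition phi11 :: "real \<Rightarrow> real \<Rightarrow> real \<Rightarrow> real \<Rightarrow> real" where
  "phi11 a b q z =
     (\<Sum>j. qpoch a q j / (qpoch b q j * qpoch q q j) * (-1) ^ j * q ^ (j * (j - 1) div 2) * z ^ j)"

definition phi01 :: "real \<Rightarrow> real \<Rightarrow> real \<Rightarrow> real" where
  "phi01 b q z = (\<Sum>j. q ^ (j * (j - 1)) * z ^ j / (qpoch b q j * qpoch q q j))"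

text \<open>Jackson's second q-Bessel function; only its values at \<open>x > 0\<close> are meaningful.\<close>

definition jackson_J2 :: "real \<Rightarrow> real \<Rightarrow> real \<Rightarrow> real" where
  "jackson_J2 \<alpha> x q =
     qpoch_inf (q powr (\<alpha> + 1)) q / qpoch_inf q q * (x / 2) powr \<alpha>
       * phi01 (q powr (\<alpha> + 1)) q (- (q powr (\<alpha> + 1)) * x\<^sup>2 / 4)"

text \<open>The index arguments \<open>x\<close> and \<open>y\<close> are real so that the limit \<open>y \<rightarrow> x\<close> makes sense.\<close>

definition bessel_kernel :: "real \<Rightarrow> real \<Rightarrow> real \<Rightarrow> real \<Rightarrow> real \<Rightarrow> real" where
  "bessel_kernel q c \<alpha> x y =
     c powr (1/2 - \<alpha>) / (q powr x - q powr y) *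
       (q powr (x/2) * jackson_J2 (\<alpha> + 1) (2 * sqrt c * q powr (x/2)) q
                     * jackson_J2 \<alpha> (2 * sqrt c * q powr (y/2)) q
        - q powr (y/2) * jackson_J2 (\<alpha> + 1) (2 * sqrt c * q powr (y/2)) q
                       * jackson_J2 \<alpha> (2 * sqrt c * q powr (x/2)) q)"

definition bessel_term :: "real \<Rightarrow> real \<Rightarrow> real \<Rightarrow> int \<Rightarrow> int \<Rightarrow> real" where
  "bessel_term q c \<alpha> k l =
     (if k = l then Lim (at (real_of_int k)) (\<lambda>y. bessel_kernel q c \<alpha> (real_of_int k) y)
      else bessel_kernel q c \<alpha> (real_of_int k) (real_of_int l))"

definition bilateral_summand :: "real \<Rightarrow> real \<Rightarrow> real \<Rightarrow> int \<Rightarrow> int \<Rightarrow> int \<Rightarrow> real" where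
  "bilateral_summand q c \<alpha> k l p =
     q powi p
     * (qpoch_inf (- (q powr (real_of_int p + 1 - \<alpha>) / c)) q / qpoch_inf (- (q powi (p + 1) / c)) q)
     * (qpoch_inf (q powr (\<alpha> + 1)) q / qpoch_inf q q
         * phi11 (- (c * q powr (\<alpha> - real_of_int p))) (q powr (\<alpha> + 1)) q (q powi (k + p + 1)))
     * (qpoch_inf (q powr (\<alpha> + 1)) q / qpoch_inf q q
         * phi11 (- (c * q powr (\<alpha> - real_of_int p))) (q powr (\<alpha> + 1)) q (q powi (l + p + 1)))"

end

theory Submission
  imports Defs
begin

text \<open>
  Put \<open>b = q powr (\<alpha> + 1)\<close>. As functions of \<open>p\<close>, the \<open>1\<phi>1\<close>-functions with \<open>x = q powi k\<close> solve a
  symmetric second-order recurrence with eigenvalue \<open>x\<close>, used here as a first-order system together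
  with their companions for \<open>\<alpha> + 1\<close>. So \<open>x - y\<close> times the bilateral summand is the difference of
  consecutive Casorati determinants, and the sum reduces to their boundary values. For \<open>p \<rightarrow> \<infinity>\<close> these
  tend to the q-Bessel kernel. For \<open>p \<rightarrow> -\<infinity>\<close> they are read off from the symmetry
  \<open>(b;q)\<^sub>\<infinity> 1\<phi>1(sb; b; q, z) = (z;q)\<^sub>\<infinity> 1\<phi>1(sz; z; q, b)\<close>: if \<open>z = q powi (- K)\<close>, the first
  \<open>K + 1\<close> terms on the right vanish, so the functions decay superexponentially and the determinant
  tends to \<open>0\<close>. For \<open>x = y\<close> it is replaced by its derivative; the derivatives of the vanishing terms
  grow at the reciprocal rate, and the product leaves the constant for \<open>k = l\<close>.
\<close>

section \<open>q-shifted factorials\<close>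

text \<open>The obstacle is the end where \<open>p\<close> tends to minus infinity. There the
  argument of the series is unbounded and its terms are large with alternating signs, so the decay
  is pure cancellation and no termwise estimate of the defining series can show it. After the
  exchange of \<open>b\<close> and \<open>z\<close>, with s = - c / v and z = x v, the product s z =
  - c x no longer depends on \<open>p\<close>, and the only dependence left sits in an infinite
  product with explicit zeros. The weight of the bilateral sum is the one that makes the recurrence
  symmetric. For negative \<open>p\<close> its two infinite products are inverted factor by factor;
  their Gaussian powers cancel, and what is left is an exponential times a quotient of four
  convergent products, the source of the quotient in the constant. On the diagonal three rates meet:
  the weight grows like b^p, the companion function decays, the derivative grows. All powers of
  \<open>q\<close> that depend on \<open>p\<close> cancel, and the square of (q;q) infinity
  contributed by the derivative is the one that the normalisation of the two 1phi1 factors divides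
  out.\<close>

lemma qpoch_0 [simp]: "qpoch a q 0 = 1"
  by (simp add: qpoch_def)

lemma qpoch_Suc: "qpoch a q (Suc n) = qpoch a q n * (1 - a * q ^ n)"
  by (simp add: qpoch_def)

lemma qpoch_Suc_left: "qpoch a q (Suc n) = (1 - a) * qpoch (a * q) q n"
  unfolding qpoch_def by (subst prod.lessThan_Suc_shift) (simp add: mult_ac)

lemma choose_two_0 [simp]: "0 choose 2 = 0"
  by (simp add: choose_two)

lemma choose_two_Suc: "Suc j choose 2 = (j choose 2) + j"
  by (simp add: numeral_2_eq_2)

lemma double_choose_two: "2 * (n choose 2) = n * (n - 1)"
proof -
  have "even (n * (n - 1))" by (cases n) auto
  then show ?thesis by (simp add: choose_two)
qed

lemma choose_two_add: "m + n choose 2 = (m choose 2) + (n choose 2) + m * n"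
  by (induction n) (simp_all add: choose_two_Suc)

locale q_param =
  fixes q :: real
  assumes q_pos: "0 < q" and q_less: "q < 1"
begin

lemma q_ne [simp]: "q \<noteq> 0"
  using q_pos by simp

lemma power_q_pos [simp]: "0 < q ^ n"
  using q_pos by simp

lemma power_q_le [simp]: "q ^ n \<le> 1"
  using q_pos q_less by (simp add: power_le_one)

lemma summable_power_q: "summable (\<lambda>i. a * q ^ i)"
  using q_pos q_less by (intro summable_mult summable_geometric) simp

lemma convergent_qpoch: "convergent_prod (\<lambda>i. 1 - a * q ^ i)"
proof (rule abs_convergent_prod_imp_convergent_prod)
  have "summable (\<lambda>i. norm (a * q ^ i))"
    using summable_power_q[of "\<bar>a\<bar>"] q_pos by (simp add: abs_mult)
  then show "abs_convergent_prod (\<lambda>i. 1 - a * q ^ i)"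
    by (intro summable_imp_abs_convergent_prod) simp
qed

lemma qpoch_tendsto: "(\<lambda>n. qpoch a q n) \<longlonglongrightarrow> qpoch_inf a q"
proof -
  have "(\<lambda>n. \<Prod>i\<le>n. 1 - a * q ^ i) \<longlonglongrightarrow> qpoch_inf a q"
    unfolding qpoch_inf_def by (rule convergent_prod_LIMSEQ[OF convergent_qpoch])
  then have "(\<lambda>n. qpoch a q (Suc n)) \<longlonglongrightarrow> qpoch_inf a q"
    by (simp add: qpoch_def lessThan_Suc_atMost)
  then show ?thesis
    by (rule LIMSEQ_imp_Suc)
qed

lemma qpoch_inf_rec: "qpoch_inf a q = (1 - a) * qpoch_inf (a * q) q"
proof -
  have "(\<lambda>n. qpoch a q (Suc n)) \<longlonglongrightarrow> (1 - a) * qpoch_inf (a * q) q"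
    unfolding qpoch_Suc_left by (intro tendsto_mult_left qpoch_tendsto)
  with LIMSEQ_Suc[OF qpoch_tendsto] show ?thesis
    by (rule LIMSEQ_unique)
qed

lemma qpoch_inf_split: "qpoch_inf a q = qpoch a q n * qpoch_inf (a * q ^ n) q"
proof (induction n)
  case (Suc n)
  then show ?case
    using qpoch_inf_rec[of "a * q ^ n"] by (simp add: qpoch_Suc mult_ac)
qed simp

lemma qpoch_inf_zero [simp]: "qpoch_inf 0 q = 1"
  by (simp add: qpoch_inf_def)

lemma qpoch_inf_eq_0: "a * q ^ n = 1 \<Longrightarrow> qpoch_inf a q = 0"
  using qpoch_inf_split[of a "Suc n"] by (simp add: qpoch_Suc)

lemma qpoch_ge_1: "0 \<le> R \<Longrightarrow> 1 \<le> qpoch (- R) q n"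
  unfolding qpoch_def using q_pos by (intro prod_ge_1) simp

lemma qpoch_mono: "0 \<le> R \<Longrightarrow> m \<le> n \<Longrightarrow> qpoch (- R) q m \<le> qpoch (- R) q n"
proof (rule lift_Suc_mono_le)
  fix n assume "0 \<le> R"
  then show "qpoch (- R) q n \<le> qpoch (- R) q (Suc n)"
    using qpoch_ge_1[of R n] q_pos
    by (simp add: qpoch_Suc algebra_simps)
qed

lemma qpoch_le_inf: "0 \<le> R \<Longrightarrow> qpoch (- R) q n \<le> qpoch_inf (- R) q"
  by (rule incseq_le[OF _ qpoch_tendsto]) (auto simp: incseq_def qpoch_mono)

lemma qpoch_inf_ge_1: "0 \<le> R \<Longrightarrow> 1 \<le> qpoch_inf (- R) q"
  using qpoch_le_inf[of R 0] by simp

lemma qpoch_inf_neg_pos: "0 \<le> a \<Longrightarrow> 0 < qpoch_inf (- a) q"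
  using qpoch_inf_ge_1[of a] by linarith

lemma abs_qpoch_le_qpoch: "\<bar>a\<bar> \<le> R \<Longrightarrow> \<bar>qpoch a q n\<bar> \<le> qpoch (- R) q n"
  unfolding qpoch_def abs_prod
proof (intro prod_mono conjI)
  fix i assume "\<bar>a\<bar> \<le> R"
  then have "\<bar>a * q ^ i\<bar> \<le> R * q ^ i"
    using q_pos by (simp add: abs_mult)
  then show "\<bar>1 - a * q ^ i\<bar> \<le> 1 - - R * q ^ i"
    by linarith
qed simp

lemma abs_qpoch_le: "\<bar>a\<bar> \<le> R \<Longrightarrow> \<bar>qpoch a q n\<bar> \<le> qpoch_inf (- R) q"
  using abs_qpoch_le_qpoch[of a R n] qpoch_le_inf[of R n] by linarith

lemma abs_qpoch_inf_le: "\<bar>a\<bar> \<le> R \<Longrightarrow> \<bar>qpoch_inf a q\<bar> \<le> qpoch_inf (- R) q"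
  by (rule LIMSEQ_le_const2[OF tendsto_rabs[OF qpoch_tendsto]]) (auto intro: abs_qpoch_le)

lemma qpoch_pos: "a < 1 \<Longrightarrow> 0 < qpoch a q n"
  unfolding qpoch_def
proof (rule prod_pos, safe)
  fix i assume "a < 1"
  show "0 < 1 - a * q ^ i"
  proof (cases "a \<le> 0")
    case True
    then have "a * q ^ i \<le> 0"
      using q_pos by (simp add: mult_nonpos_nonneg)
    then show ?thesis by simp
  next
    case False
    then have "a * q ^ i \<le> a * 1"
      by (intro mult_left_mono) auto
    then show ?thesis using \<open>a < 1\<close> by simp
  qed
qed

lemma qpoch_inf_pos: "a < 1 \<Longrightarrow> 0 < qpoch_inf a q"
  unfolding qpoch_inf_def
proof (rule less_0_prodinf[OF convergent_qpoch])
  fix i assume "a < 1"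
  then have "0 < qpoch a q (Suc i)" "0 < qpoch a q i"
    by (simp_all add: qpoch_pos)
  then show "0 < 1 - a * q ^ i"
    by (simp add: qpoch_Suc zero_less_mult_iff)
qed

lemma qpoch_qq_pos [simp]: "0 < qpoch q q n" "0 < qpoch_inf q q"
  using q_less by (simp_all add: qpoch_pos qpoch_inf_pos)

lemma qpoch_qq_ne [simp]: "qpoch q q n \<noteq> 0" "qpoch_inf q q \<noteq> 0"
  using qpoch_qq_pos by (metis less_irrefl)+

text \<open>The omitted factors lie between 0 and 1. Through this bound the denominators (q;q)_n
  leave every majorant, uniformly in \<open>n\<close>.\<close>

lemma qpoch_qq_ge: "qpoch_inf q q \<le> qpoch q q n"
proof -
  have "0 \<le> qpoch q q n" by (simp add: less_imp_le)
  moreover have "qpoch_inf (q * q ^ n) q \<le> 1"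
  proof (rule LIMSEQ_le_const2[OF qpoch_tendsto], intro exI allI impI)
    fix m :: nat
    show "qpoch (q * q ^ n) q m \<le> 1"
      unfolding qpoch_def
      using q_pos q_less
      by (intro prod_le_1) (auto simp flip: power_Suc power_add intro!: power_le_one)
  qed
  ultimately have "qpoch q q n * qpoch_inf (q * q ^ n) q \<le> qpoch q q n"
    by (rule mult_left_le[rotated])
  then show ?thesis
    using qpoch_inf_split[of q n] by simp
qed

lemma inverse_qpoch_qq_le: "1 / qpoch q q n \<le> 1 / qpoch_inf q q"
  using qpoch_qq_ge[of n] by (simp add: frac_le)

text \<open>The constant is independent of \<open>n\<close>, so it survives the passage to the
  infinite product. Changing the factor with index i costs a multiple of |a - b| q^i, and these
  costs sum to at most 1 / (1 - q).\<close>

lemma qpoch_lipschitz: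
  assumes "\<bar>a\<bar> \<le> R" "\<bar>b\<bar> \<le> R"
  shows "\<bar>qpoch a q n - qpoch b q n\<bar> \<le> qpoch_inf (- R) q / (1 - q) * \<bar>a - b\<bar>"
proof -
  have R: "0 \<le> R" using assms by linarith
  have *: "\<bar>qpoch a q n - qpoch b q n\<bar> \<le> \<bar>a - b\<bar> * qpoch (- R) q n * (\<Sum>i<n. q ^ i)"
  proof (induction n)
    case (Suc n)
    let ?P = "qpoch (- R) q n" and ?S = "\<Sum>i<n. q ^ i"
    have P: "1 \<le> ?P" using qpoch_ge_1[OF R] .
    have "\<bar>a * q ^ n\<bar> \<le> R * q ^ n" using assms q_pos by (simp add: abs_mult)
    then have a1: "\<bar>1 - a * q ^ n\<bar> \<le> 1 + R * q ^ n" by linarith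
    have eq: "qpoch a q (Suc n) - qpoch b q (Suc n)
        = (qpoch a q n - qpoch b q n) * (1 - a * q ^ n) - qpoch b q n * ((a - b) * q ^ n)"
      by (simp add: qpoch_Suc algebra_simps)
    have "\<bar>qpoch a q (Suc n) - qpoch b q (Suc n)\<bar>
        \<le> \<bar>qpoch a q n - qpoch b q n\<bar> * \<bar>1 - a * q ^ n\<bar> + \<bar>qpoch b q n\<bar> * (\<bar>a - b\<bar> * q ^ n)"
      unfolding eq using q_pos by (intro order.trans[OF abs_triangle_ineq4]) (simp add: abs_mult)
    also have "\<dots> \<le> (\<bar>a - b\<bar> * ?P * ?S) * (1 + R * q ^ n) + ?P * (\<bar>a - b\<bar> * q ^ n)"
      using Suc a1 abs_qpoch_le_qpoch[OF assms(2), of n] P R q_pos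
      by (intro add_mono mult_mono) (auto simp: sum_nonneg)
    \<comment> \<open>The second summand is enlarged by 1 + R q^n so that both contain
      \<open>qpoch (- R) q (Suc n)\<close>.\<close>
    also have "\<dots> \<le> (\<bar>a - b\<bar> * ?P * ?S) * (1 + R * q ^ n)
        + ?P * (\<bar>a - b\<bar> * q ^ n) * (1 + R * q ^ n)"
    proof (rule add_left_mono)
      have "?P * (\<bar>a - b\<bar> * q ^ n) * 1 \<le> ?P * (\<bar>a - b\<bar> * q ^ n) * (1 + R * q ^ n)"
        using P R q_pos by (intro mult_left_mono) auto
      then show "?P * (\<bar>a - b\<bar> * q ^ n) \<le> ?P * (\<bar>a - b\<bar> * q ^ n) * (1 + R * q ^ n)"
        by simp
    qed
    also have "\<dots> = \<bar>a - b\<bar> * qpoch (- R) q (Suc n) * (\<Sum>i<Suc n. q ^ i)"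
      by (simp add: qpoch_Suc algebra_simps)
    finally show ?case .
  qed simp
  have "(\<Sum>i<n. q ^ i) \<le> 1 / (1 - q)"
    using q_pos q_less by (simp add: sum_gp_strict divide_right_mono)
  then have "\<bar>a - b\<bar> * qpoch (- R) q n * (\<Sum>i<n. q ^ i)
      \<le> \<bar>a - b\<bar> * qpoch_inf (- R) q * (1 / (1 - q))"
    using qpoch_le_inf[OF R, of n] qpoch_ge_1[OF R, of n] q_pos
    by (intro mult_mono) (auto simp: sum_nonneg)
  with * show ?thesis by (simp add: field_simps)
qed

lemma qpoch_inf_lipschitz:
  assumes "\<bar>a\<bar> \<le> R" "\<bar>b\<bar> \<le> R"
  shows "\<bar>qpoch_inf a q - qpoch_inf b q\<bar> \<le> qpoch_inf (- R) q / (1 - q) * \<bar>a - b\<bar>"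
  using qpoch_lipschitz[OF assms]
  by (intro LIMSEQ_le_const2[OF tendsto_rabs[OF tendsto_diff[OF qpoch_tendsto qpoch_tendsto]]]) auto

lemma isCont_qpoch_inf: "isCont (\<lambda>a. qpoch_inf a q) b"
proof -
  define L where "L = qpoch_inf (- (\<bar>b\<bar> + 1)) q / (1 - q)"
  have "((\<lambda>a. qpoch_inf a q - qpoch_inf b q) \<longlongrightarrow> 0) (at b)"
  proof (rule Lim_null_comparison)
    show "\<forall>\<^sub>F a in at b. norm (qpoch_inf a q - qpoch_inf b q) \<le> L * \<bar>a - b\<bar>"
      unfolding eventually_at
    proof (intro exI[of _ 1] conjI ballI impI)
      fix a assume "a \<noteq> b \<and> dist a b < 1"
      then have "\<bar>a\<bar> \<le> \<bar>b\<bar> + 1" "\<bar>b\<bar> \<le> \<bar>b\<bar> + 1"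
        by (auto simp: dist_real_def)
      from qpoch_inf_lipschitz[OF this]
      show "norm (qpoch_inf a q - qpoch_inf b q) \<le> L * \<bar>a - b\<bar>"
        by (simp add: L_def)
    qed simp
    show "((\<lambda>a. L * \<bar>a - b\<bar>) \<longlongrightarrow> 0) (at b)"
      by (auto intro!: tendsto_eq_intros)
  qed
  then show ?thesis
    by (simp add: isCont_def LIM_zero_iff)
qed

lemma tendsto_qpoch_inf:
  "(f \<longlongrightarrow> a) F \<Longrightarrow> ((\<lambda>x. qpoch_inf (f x) q) \<longlongrightarrow> qpoch_inf a q) F"
  by (rule isCont_tendsto_compose[OF isCont_qpoch_inf])

lemma tendsto_qpoch: "(f \<longlongrightarrow> a) F \<Longrightarrow> ((\<lambda>x. qpoch (f x) q n) \<longlongrightarrow> qpoch a q n) F"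
  unfolding qpoch_def by (intro tendsto_intros)

text \<open>Each new factor 1 - a / q^i equals (- a / q^i) (1 - q^i / a). This separates the
  explicit growth from a product that converges as \<open>n\<close> grows, as needed for the weight
  at negative index.\<close>

lemma qpoch_inf_shift_back:
  assumes "a \<noteq> 0"
  shows "qpoch_inf (a / q ^ n) q
    = (- a) ^ n / q ^ (Suc n choose 2) * qpoch (q / a) q n * qpoch_inf a q"
proof (induction n)
  case (Suc n)
  have "qpoch_inf (a / q ^ Suc n) q = (1 - a / q ^ Suc n) * qpoch_inf (a / q ^ n) q"
    using qpoch_inf_rec[of "a / q ^ Suc n"] by simp
  moreover have "1 - a / q ^ Suc n = (- a) / q ^ Suc n * (1 - q / a * q ^ n)"
    using assms by (simp add: field_simps)
  ultimately show ?case
    using Suc by (simp add: qpoch_Suc choose_two_Suc[of "Suc n"] power_add mult_ac)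
qed (simp add: choose_two)

text \<open>The Gaussian factor beats every geometric one; nearly all majorants below have this
  form.\<close>

lemma summable_theta:
  shows "summable (\<lambda>j. q ^ (j choose 2) * r ^ j)"
proof -
  have "(\<lambda>j. q ^ j * \<bar>r\<bar>) \<longlonglongrightarrow> 0 * \<bar>r\<bar>"
    using q_pos q_less by (intro tendsto_mult_right LIMSEQ_realpow_zero) auto
  then have "\<forall>\<^sub>F j in sequentially. q ^ j * \<bar>r\<bar> < 1/2"
    by (intro order_tendstoD) auto
  then obtain N where N: "\<And>j. j \<ge> N \<Longrightarrow> q ^ j * \<bar>r\<bar> < 1/2"
    by (auto simp: eventually_sequentially)
  show ?thesis
  proof (rule summable_ratio_test[of "1/2" N])
    fix j assume "N \<le> j"
    then have "\<bar>q ^ (j choose 2) * r ^ j\<bar> * (q ^ j * \<bar>r\<bar>) \<le> \<bar>q ^ (j choose 2) * r ^ j\<bar> * (1/2)"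
      by (intro mult_left_mono less_imp_le[OF N]) auto
    moreover have "norm (q ^ (Suc j choose 2) * r ^ Suc j)
        = \<bar>q ^ (j choose 2) * r ^ j\<bar> * (q ^ j * \<bar>r\<bar>)"
      using q_pos by (simp add: choose_two_Suc power_add abs_mult)
    ultimately show "norm (q ^ (Suc j choose 2) * r ^ Suc j) \<le> 1 / 2 * norm (q ^ (j choose 2) * r ^ j)"
      by (simp only: real_norm_def mult.commute[of "1 / 2"])
  qed simp
qed

end

section \<open>A symmetry of the \<open>1\<phi>1\<close>-series\<close>

context q_param
begin

text \<open>\<open>heine s b z\<close> is \<open>(b;q)\<^sub>\<infinity> 1\<phi>1(sb; b; q, z)\<close>, normalised so that it has no poles in \<open>b\<close>.\<close>

definition heine_term :: "real \<Rightarrow> real \<Rightarrow> real \<Rightarrow> nat \<Rightarrow> real" where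
  "heine_term s b z j =
     qpoch (s * b) q j / qpoch q q j * (- z) ^ j * q ^ (j choose 2) * qpoch_inf (b * q ^ j) q"

definition heine :: "real \<Rightarrow> real \<Rightarrow> real \<Rightarrow> real" where
  "heine s b z = (\<Sum>j. heine_term s b z j)"

lemma abs_mult_power_q_le: "\<bar>b\<bar> \<le> R \<Longrightarrow> \<bar>b * q ^ j\<bar> \<le> R"
  using mult_left_mono[of "q ^ j" 1 "\<bar>b\<bar>"] q_pos by (simp add: abs_mult)

lemma heine_term_bound:
  assumes "\<bar>s * b\<bar> \<le> R" "\<bar>b\<bar> \<le> R"
  shows "\<bar>heine_term s b z j\<bar> \<le> (qpoch_inf (- R) q)\<^sup>2 / qpoch_inf q q * (q ^ (j choose 2) * \<bar>z\<bar> ^ j)"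
proof -
  let ?Q = "qpoch_inf (- R) q"
  have R: "0 \<le> R" using assms(2) by linarith
  have "\<bar>heine_term s b z j\<bar> = \<bar>qpoch (s * b) q j\<bar> * (1 / qpoch q q j) *
      (\<bar>qpoch_inf (b * q ^ j) q\<bar> * (q ^ (j choose 2) * \<bar>z\<bar> ^ j))"
    using q_pos by (simp add: heine_term_def abs_mult power_abs less_imp_le)
  also have "\<dots> \<le> ?Q * (1 / qpoch_inf q q) * (?Q * (q ^ (j choose 2) * \<bar>z\<bar> ^ j))"
    using assms R q_pos qpoch_inf_ge_1[OF R]
    by (intro mult_mono inverse_qpoch_qq_le abs_qpoch_le abs_qpoch_inf_le abs_mult_power_q_le)
      (auto simp: less_imp_le intro!: mult_nonneg_nonneg)
  finally show ?thesis by (simp add: power2_eq_square)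
qed

lemma summable_heine_term: "summable (heine_term s b z)"
proof (rule summable_comparison_test')
  define R where "R = \<bar>s * b\<bar> + \<bar>b\<bar>"
  show "summable (\<lambda>j. (qpoch_inf (- R) q)\<^sup>2 / qpoch_inf q q * (q ^ (j choose 2) * \<bar>z\<bar> ^ j))"
    by (intro summable_mult summable_theta)
  show "norm (heine_term s b z j) \<le> (qpoch_inf (- R) q)\<^sup>2 / qpoch_inf q q * (q ^ (j choose 2) * \<bar>z\<bar> ^ j)"
    for j
    using heine_term_bound[of s b R] by (simp add: R_def)
qed

text \<open>The difference of the terms at \<open>z\<close> and \<open>z * q\<close> carries
  \<open>e\<close>, the last factor of (q;q) with index i + 1. Cancelling it lowers the index and
  leaves a term at the shifted arguments.\<close>

lemma heine_z_rec: "heine s b z = heine s b (z * q) - z * (1 - s * b) * heine s (b * q) (z * q)"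
proof -
  have step: "heine_term s b z (Suc i) - heine_term s b (z * q) (Suc i)
      = - z * (1 - s * b) * heine_term s (b * q) (z * q) i" for i
  proof -
    note pm = power_minus[of "z * q"] power_minus[of "q * z"] power_minus[of z] power_minus[of q]
      power_mult_distrib
    define e where "e = 1 - q ^ Suc i"
    have Q: "qpoch q q (Suc i) = qpoch q q i * e"
      by (simp add: qpoch_Suc e_def)
    then have e: "e \<noteq> 0"
      using qpoch_qq_ne(1)[of "Suc i"] by auto
    define X where "X = (1 - s * b) * qpoch (s * b * q) q i * (- z) ^ Suc i * q ^ (i choose 2) * q ^ i
      * qpoch_inf (b * q ^ Suc i) q"
    have "heine_term s b z (Suc i) = X / (qpoch q q i * e)"
      by (simp add: heine_term_def choose_two_Suc qpoch_Suc_left[of "s * b"] Q X_def power_add)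
    moreover have "heine_term s b (z * q) (Suc i) = X / (qpoch q q i * e) * q ^ Suc i"
      by (simp add: heine_term_def choose_two_Suc qpoch_Suc_left[of "s * b"] Q X_def power_add
          pm)
    moreover have "- z * (1 - s * b) * heine_term s (b * q) (z * q) i = X / qpoch q q i"
      by (simp add: heine_term_def X_def pm
          mult_ac)
    moreover have "X / (qpoch q q i * e) - X / (qpoch q q i * e) * q ^ Suc i
        = X / (qpoch q q i * e) * e"
      by (simp only: e_def right_diff_distrib mult_1_right)
    ultimately show ?thesis
      using e by simp
  qed
  have "(\<lambda>j. heine_term s b z j - heine_term s b (z * q) j) sums (heine s b z - heine s b (z * q))"
    unfolding heine_def by (intro sums_diff summable_sums summable_heine_term)
  then have "(\<lambda>i. - z * (1 - s * b) * heine_term s (b * q) (z * q) i)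
      sums (heine s b z - heine s b (z * q))"
    unfolding step[symmetric] by (subst sums_Suc_iff) (simp add: heine_term_def)
  moreover have "(\<lambda>i. - z * (1 - s * b) * heine_term s (b * q) (z * q) i)
      sums (- z * (1 - s * b) * heine s (b * q) (z * q))"
    unfolding heine_def by (intro sums_mult summable_sums summable_heine_term)
  ultimately have "heine s b z - heine s b (z * q) = - z * (1 - s * b) * heine s (b * q) (z * q)"
    by (rule sums_unique2)
  then show ?thesis by linarith
qed

text \<open>The mirror image of \<open>heine_z_rec\<close> under the exchange of \<open>b\<close>
  and \<open>z\<close>, although the series is not visibly symmetric. The two relations together
  force the symmetry.\<close>

lemma heine_b_rec: "heine s b z = heine s (b * q) z - b * (1 - s * z) * heine s (b * q) (z * q)"
proof -
  \<comment> \<open>The coefficient b (1 - s z) is split: the part with \<open>b\<close> combines at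
    equal index, while the part with s b z appears only after the index shift in
    \<open>step\<close>.\<close>
  define t where "t j = heine_term s b z j - heine_term s (b * q) z j
    + b * heine_term s (b * q) (z * q) j" for j
  have step: "t (Suc i) = s * b * z * heine_term s (b * q) (z * q) i" for i
  proof -
    note pm = power_minus[of "z * q"] power_minus[of "q * z"] power_minus[of z] power_minus[of q]
      power_mult_distrib
    define e where "e = 1 - q ^ Suc i"
    have Q: "qpoch q q (Suc i) = qpoch q q i * e"
      by (simp add: qpoch_Suc e_def)
    then have e: "e \<noteq> 0"
      using qpoch_qq_ne(1)[of "Suc i"] by auto
    define P W where "P = qpoch (s * b * q) q i" and "W = qpoch_inf (b * q * q ^ Suc i) q"
    have P: "qpoch (s * b) q (Suc i) = (1 - s * b) * P"
      "qpoch (s * (b * q)) q (Suc i) = P * (1 - s * b * q ^ Suc i)"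
      "qpoch (s * (b * q)) q i = P"
      by (simp only: P_def qpoch_Suc_left[of "s * b"] mult.assoc)
        (simp_all add: P_def qpoch_Suc mult_ac)
    have W: "qpoch_inf (b * q ^ Suc i) q = (1 - b * q ^ Suc i) * W"
      "qpoch_inf (b * q * q ^ i) q = (1 - b * q ^ Suc i) * W"
      unfolding W_def using qpoch_inf_rec[of "b * q ^ Suc i"] by (simp_all add: mult_ac)
    define X where "X = P * (- z) ^ Suc i * q ^ (i choose 2) * q ^ i * W"
    have "t (Suc i) = X / (qpoch q q i * e) *
        ((1 - s * b) * (1 - b * q ^ Suc i) - (1 - s * b * q ^ Suc i)
          + b * (1 - s * b * q ^ Suc i) * q ^ Suc i)"
      unfolding t_def heine_term_def choose_two_Suc Q P W X_def W_def[symmetric]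
      by (simp add: power_add pm
          diff_divide_distrib add_divide_distrib algebra_simps)
    also have "(1 - s * b) * (1 - b * q ^ Suc i) - (1 - s * b * q ^ Suc i)
          + b * (1 - s * b * q ^ Suc i) * q ^ Suc i = - (s * b) * (1 - b * q ^ Suc i) * e"
      by (simp add: e_def algebra_simps)
    also have "X / (qpoch q q i * e) * (- (s * b) * (1 - b * q ^ Suc i) * e)
        = - (s * b) * (1 - b * q ^ Suc i) * X / qpoch q q i"
      using e by simp
    also have "\<dots> = s * b * z * heine_term s (b * q) (z * q) i"
      unfolding heine_term_def P W X_def
      by (simp add: pm)
    finally show ?thesis .
  qed
  have "t sums (heine s b z - heine s (b * q) z + b * heine s (b * q) (z * q))"
    unfolding heine_def t_def
    by (intro sums_add sums_diff sums_mult summable_sums summable_heine_term)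
  moreover have "t 0 = 0"
    using qpoch_inf_rec[of b] by (simp add: t_def heine_term_def algebra_simps)
  ultimately have "(\<lambda>i. s * b * z * heine_term s (b * q) (z * q) i)
      sums (heine s b z - heine s (b * q) z + b * heine s (b * q) (z * q))"
    unfolding step[symmetric] by (subst sums_Suc_iff) simp
  moreover have "(\<lambda>i. s * b * z * heine_term s (b * q) (z * q) i)
      sums (s * b * z * heine s (b * q) (z * q))"
    unfolding heine_def by (intro sums_mult summable_sums summable_heine_term)
  ultimately have "heine s b z - heine s (b * q) z + b * heine s (b * q) (z * q)
      = s * b * z * heine s (b * q) (z * q)"
    by (rule sums_unique2)
  then show ?thesis by (simp add: algebra_simps)
qed

text \<open>The zeroth term is (b;q) infinity and every later one contains \<open>z\<close>. Both
  constants depend on \<open>R\<close> alone, so the bound is uniform over all points (b q^i, z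
  q^j).\<close>

lemma heine_near_one:
  assumes "\<bar>s * b\<bar> \<le> R" "\<bar>b\<bar> \<le> R" "\<bar>z\<bar> \<le> R"
  shows "\<bar>heine s b z - 1\<bar> \<le>
    qpoch_inf (- R) q / (1 - q) * \<bar>b\<bar>
     + (qpoch_inf (- R) q)\<^sup>2 / qpoch_inf q q * (\<Sum>j. q ^ (j choose 2) * R ^ j) * \<bar>z\<bar>"
proof -
  define M where "M = (qpoch_inf (- R) q)\<^sup>2 / qpoch_inf q q"
  have R: "0 \<le> R" and M: "0 \<le> M" using assms by (auto simp: M_def less_imp_le)
  have bound: "norm (heine_term s b z (Suc i)) \<le> M * \<bar>z\<bar> * (q ^ (i choose 2) * R ^ i)" for i
  proof -
    have "norm (heine_term s b z (Suc i)) \<le> M * (q ^ (Suc i choose 2) * \<bar>z\<bar> ^ Suc i)"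
      unfolding M_def real_norm_def by (rule heine_term_bound) fact+
    also have "\<dots> \<le> M * (q ^ (i choose 2) * (\<bar>z\<bar> * R ^ i))"
    proof (intro mult_left_mono mult_mono M)
      show "q ^ (Suc i choose 2) \<le> q ^ (i choose 2)"
        using q_pos q_less by (intro power_decreasing) (auto simp: choose_two_Suc)
      show "\<bar>z\<bar> ^ Suc i \<le> \<bar>z\<bar> * R ^ i"
        using assms by (auto intro!: mult_left_mono power_mono)
    qed (use q_pos in auto)
    finally show ?thesis by (simp add: mult_ac)
  qed
  have sm: "summable (\<lambda>i. M * \<bar>z\<bar> * (q ^ (i choose 2) * R ^ i))"
    by (intro summable_mult summable_theta)
  have "heine s b z = qpoch_inf b q + (\<Sum>i. heine_term s b z (Suc i))"
    unfolding heine_def using suminf_split_head[OF summable_heine_term, of s b z]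
    by (simp add: heine_term_def)
  moreover have "\<bar>\<Sum>i. heine_term s b z (Suc i)\<bar> \<le> (\<Sum>i. M * \<bar>z\<bar> * (q ^ (i choose 2) * R ^ i))"
  proof -
    have sa: "summable (\<lambda>i. norm (heine_term s b z (Suc i)))"
      by (rule summable_comparison_test'[OF sm, of 0]) (use bound in simp)
    show ?thesis
      using order.trans[OF summable_norm[OF sa] suminf_le[OF bound sa sm]] by simp
  qed
  moreover have "\<dots> = M * (\<Sum>j. q ^ (j choose 2) * R ^ j) * \<bar>z\<bar>"
    by (subst suminf_mult) (auto intro: summable_theta)
  moreover have "\<bar>qpoch_inf b q - qpoch_inf 0 q\<bar> \<le> qpoch_inf (- R) q / (1 - q) * \<bar>b - 0\<bar>"
    using assms R by (intro qpoch_inf_lipschitz) auto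
  ultimately show ?thesis
    unfolding M_def[symmetric] qpoch_inf_zero by simp
qed

text \<open>Uniqueness for the functional equations behind the symmetry: both arguments are pushed to \<open>0\<close>,
  where the series tends to \<open>1\<close>, at the cost of a convergent product.\<close>

lemma two_index_vanish:
  fixes D :: "nat \<Rightarrow> nat \<Rightarrow> real"
  assumes C: "0 \<le> C"
    and right: "\<And>i j. \<bar>D i j\<bar> \<le> \<bar>D i (Suc j)\<bar> + C * q ^ j * \<bar>D (Suc i) (Suc j)\<bar>"
    and left: "\<And>i j. \<bar>D i j\<bar> \<le> \<bar>D (Suc i) j\<bar> + C * q ^ i * \<bar>D (Suc i) (Suc j)\<bar>"
    and small: "\<And>i j. \<bar>D i j\<bar> \<le> E * (q ^ i + q ^ j)"
  shows "D i j = 0"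
proof -
  have coeff: "C * q ^ i * x \<le> C * q ^ n * B" if "n \<le> i" "0 \<le> x" "x \<le> B" for i n x B
    using that C q_pos q_less by (intro mult_mono power_decreasing) auto
  \<comment> \<open>Lowering the threshold from n + 1 to n costs 1 + C q^n once for each index:
    \<open>right\<close> first reaches j = n while i stays above n, then \<open>left\<close> reaches
    i = n. The accumulated cost stays bounded because the product converges.\<close>
  have iter: "\<bar>D i j\<bar> \<le> B * (qpoch (- C) q n)\<^sup>2"
    if "\<And>i j. n \<le> i \<Longrightarrow> n \<le> j \<Longrightarrow> \<bar>D i j\<bar> \<le> B" for n B i j
    using that
  proof (induction n arbitrary: B i j)
    case (Suc n)
    have B: "0 \<le> B" using Suc.prems[of "Suc n" "Suc n"] by linarith
    have c: "0 \<le> C * q ^ n" using C q_pos by simp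
    have 1: "\<bar>D i j\<bar> \<le> B * (1 + C * q ^ n)" if "Suc n \<le> i" "n \<le> j" for i j
    proof -
      have "\<bar>D i j\<bar> \<le> B + C * q ^ n * B"
        using that by (intro order.trans[OF right] add_mono coeff Suc.prems) auto
      then show ?thesis by (simp add: algebra_simps)
    qed
    have 2: "\<bar>D i j\<bar> \<le> B * (1 + C * q ^ n)\<^sup>2" if "n \<le> i" "n \<le> j" for i j
    proof -
      have "\<bar>D i j\<bar> \<le> B * (1 + C * q ^ n) + C * q ^ n * (B * (1 + C * q ^ n))"
        using that by (intro order.trans[OF left] add_mono coeff 1) auto
      then show ?thesis by (simp add: algebra_simps power2_eq_square)
    qed
    show ?case
      using Suc.IH[of "B * (1 + C * q ^ n)\<^sup>2" i j] 2 by (simp add: qpoch_Suc power_mult_distrib mult_ac)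
  qed simp
  have E: "0 \<le> E" using order.trans[OF abs_ge_zero small[of 0 0]] by simp
  have "\<bar>D i j\<bar> \<le> 2 * E * (qpoch_inf (- C) q)\<^sup>2 * q ^ n" for n
  proof -
    have "\<bar>D i j\<bar> \<le> E * (q ^ n + q ^ n)" if "n \<le> i" "n \<le> j" for i j
      using that E q_pos q_less by (intro order.trans[OF small] mult_left_mono add_mono power_decreasing) auto
    then have "\<bar>D i j\<bar> \<le> E * (q ^ n + q ^ n) * (qpoch (- C) q n)\<^sup>2"
      by (rule iter)
    also have "\<dots> \<le> E * (q ^ n + q ^ n) * (qpoch_inf (- C) q)\<^sup>2"
      using qpoch_le_inf[OF C, of n] qpoch_ge_1[OF C, of n] E q_pos
      by (intro mult_left_mono power_mono) auto
    finally show ?thesis by (simp add: algebra_simps)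
  qed
  moreover have "(\<lambda>n. 2 * E * (qpoch_inf (- C) q)\<^sup>2 * q ^ n) \<longlonglongrightarrow> 2 * E * (qpoch_inf (- C) q)\<^sup>2 * 0"
    using q_pos q_less by (intro tendsto_mult_left LIMSEQ_realpow_zero) auto
  ultimately have "\<bar>D i j\<bar> \<le> 0"
    by (intro LIMSEQ_le_const[where X = "\<lambda>n. 2 * E * (qpoch_inf (- C) q)\<^sup>2 * q ^ n"]) auto
  then show ?thesis by simp
qed

text \<open>By \<open>heine_z_rec\<close> and \<open>heine_b_rec\<close> both sides satisfy the same
  pair of recurrences, and both are close to 1 near the origin. Hence their difference on the
  lattice (b q^i, z q^j) falls under \<open>two_index_vanish\<close>.\<close>

lemma heine_sym: "heine s b z = heine s z b"
proof -
  define R where "R = \<bar>s * b\<bar> + \<bar>s * z\<bar> + \<bar>b\<bar> + \<bar>z\<bar>"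
  define C where "C = R * (1 + R)"
  define K1 where "K1 = qpoch_inf (- R) q / (1 - q)"
  define K2 where "K2 = (qpoch_inf (- R) q)\<^sup>2 / qpoch_inf q q * (\<Sum>j. q ^ (j choose 2) * R ^ j)"
  define D where "D i j = heine s (b * q ^ i) (z * q ^ j) - heine s (z * q ^ j) (b * q ^ i)" for i j
  have R: "\<bar>s * b\<bar> \<le> R" "\<bar>s * z\<bar> \<le> R" "\<bar>b\<bar> \<le> R" "\<bar>z\<bar> \<le> R" "0 \<le> R"
    by (auto simp: R_def)
  have Rq: "\<bar>s * (b * q ^ i)\<bar> \<le> R" "\<bar>s * (z * q ^ i)\<bar> \<le> R" "\<bar>b * q ^ i\<bar> \<le> R" "\<bar>z * q ^ i\<bar> \<le> R" for i
    using R abs_mult_power_q_le[of "s * b" R i] abs_mult_power_q_le[of "s * z" R i]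
    by (auto intro!: abs_mult_power_q_le simp: mult.assoc)
  have K: "0 \<le> K1" "0 \<le> K2"
    using R q_pos q_less qpoch_inf_ge_1[of R]
    by (auto simp: K1_def K2_def less_imp_le
        intro!: mult_nonneg_nonneg divide_nonneg_pos suminf_nonneg summable_theta)
  have coeff: "\<bar>a * q ^ n * (1 - t)\<bar> * y \<le> C * q ^ n * y" if "\<bar>a\<bar> \<le> R" "\<bar>t\<bar> \<le> R" "0 \<le> y" for a t n y
  proof -
    have "\<bar>a\<bar> * \<bar>1 - t\<bar> \<le> R * (1 + R)"
      using that by (intro mult_mono) auto
    then have "\<bar>a\<bar> * \<bar>1 - t\<bar> * (q ^ n * y) \<le> R * (1 + R) * (q ^ n * y)"
      using that q_pos by (intro mult_right_mono) auto
    then show ?thesis using q_pos by (simp add: C_def abs_mult mult_ac)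
  qed
  have rec_right: "D i j = D i (Suc j) - z * q ^ j * (1 - s * (b * q ^ i)) * D (Suc i) (Suc j)" for i j
    unfolding D_def
    using heine_z_rec[of s "b * q ^ i" "z * q ^ j"] heine_b_rec[of s "z * q ^ j" "b * q ^ i"]
    by (simp add: mult_ac algebra_simps)
  have rec_left: "D i j = D (Suc i) j - b * q ^ i * (1 - s * (z * q ^ j)) * D (Suc i) (Suc j)" for i j
    unfolding D_def
    using heine_b_rec[of s "b * q ^ i" "z * q ^ j"] heine_z_rec[of s "z * q ^ j" "b * q ^ i"]
    by (simp add: mult_ac algebra_simps)
  have "D 0 0 = 0"
  proof (rule two_index_vanish[where D = D and C = C and E = "(K1 + K2) * R"])
    show "0 \<le> C" using R by (simp add: C_def)
    show "\<bar>D i j\<bar> \<le> \<bar>D i (Suc j)\<bar> + C * q ^ j * \<bar>D (Suc i) (Suc j)\<bar>" for i j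
      using coeff[OF R(4) Rq(1)[of i], of "\<bar>D (Suc i) (Suc j)\<bar>" j] rec_right[of i j]
        abs_triangle_ineq4[of "D i (Suc j)" "z * q ^ j * (1 - s * (b * q ^ i)) * D (Suc i) (Suc j)"]
      by (simp add: abs_mult)
    show "\<bar>D i j\<bar> \<le> \<bar>D (Suc i) j\<bar> + C * q ^ i * \<bar>D (Suc i) (Suc j)\<bar>" for i j
      using coeff[OF R(3) Rq(2)[of j], of "\<bar>D (Suc i) (Suc j)\<bar>" i] rec_left[of i j]
        abs_triangle_ineq4[of "D (Suc i) j" "b * q ^ i * (1 - s * (z * q ^ j)) * D (Suc i) (Suc j)"]
      by (simp add: abs_mult)
    fix i j
    have "\<bar>D i j\<bar> \<le> (K1 * \<bar>b * q ^ i\<bar> + K2 * \<bar>z * q ^ j\<bar>) + (K1 * \<bar>z * q ^ j\<bar> + K2 * \<bar>b * q ^ i\<bar>)"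
      unfolding D_def K1_def K2_def
      using heine_near_one[OF Rq(1,3)[of i] Rq(4)[of j]] heine_near_one[OF Rq(2,4)[of j] Rq(3)[of i]]
      by linarith
    also have "\<dots> \<le> (K1 * (R * q ^ i) + K2 * (R * q ^ j)) + (K1 * (R * q ^ j) + K2 * (R * q ^ i))"
      using K R q_pos by (intro add_mono mult_left_mono) (auto simp: abs_mult)
    finally show "\<bar>D i j\<bar> \<le> (K1 + K2) * R * (q ^ i + q ^ j)"
      by (simp add: algebra_simps)
  qed
  then show ?thesis by (simp add: D_def)
qed

end

section \<open>The series interpolating between \<open>1\<phi>1\<close> and the q-Bessel functions\<close>

text \<open>Serves to bound the derivative of a series tail from its Lipschitz constant, without
  differentiating the tail term by term.\<close>

lemma abs_DERIV_le_lipschitz: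
  fixes f :: "real \<Rightarrow> real"
  assumes "(f has_field_derivative D) (at x)" and "0 < d"
    and lip: "\<And>y. \<bar>y - x\<bar> < d \<Longrightarrow> \<bar>f y - f x\<bar> \<le> L * \<bar>y - x\<bar>"
  shows "\<bar>D\<bar> \<le> L"
proof (rule tendsto_upperbound)
  show "((\<lambda>y. \<bar>(f y - f x) / (y - x)\<bar>) \<longlongrightarrow> \<bar>D\<bar>) (at x)"
    using assms(1) by (intro tendsto_rabs) (simp add: has_field_derivative_iff)
  show "\<forall>\<^sub>F y in at x. \<bar>(f y - f x) / (y - x)\<bar> \<le> L"
    unfolding eventually_at
    using assms(2) lip by (intro exI[of _ d]) (auto simp: dist_real_def divide_simps)
qed simp

locale q_bessel = q_param +
  fixes c :: real
  assumes c_pos: "0 < c"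
begin

text \<open>This is v^j (- a / v; q)_j with the divisions cleared. At v = 0 it becomes a^j q^(j (j -
  1) / 2), which supplies the second Gaussian factor of the 0phi1-series.\<close>

definition shifted_prod :: "real \<Rightarrow> real \<Rightarrow> nat \<Rightarrow> real" where
  "shifted_prod a v j = (\<Prod>i<j. v + a * q ^ i)"

lemma shifted_prod_0 [simp]: "shifted_prod a v 0 = 1"
  by (simp add: shifted_prod_def)

lemma shifted_prod_Suc: "shifted_prod a v (Suc j) = shifted_prod a v j * (v + a * q ^ j)"
  by (simp add: shifted_prod_def)

lemma shifted_prod_Suc_left: "shifted_prod a v (Suc j) = (v + a) * shifted_prod (a * q) v j"
  unfolding shifted_prod_def by (subst prod.lessThan_Suc_shift) (simp add: mult_ac)

lemma shifted_prod_scale: "shifted_prod (a * q) (v * q) j = q ^ j * shifted_prod a v j"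
proof -
  have "shifted_prod (a * q) (v * q) j = (\<Prod>i<j. q * (v + a * q ^ i))"
    unfolding shifted_prod_def by (intro prod.cong) (auto simp: algebra_simps)
  then show ?thesis
    by (simp add: shifted_prod_def prod.distrib)
qed

lemma abs_shifted_prod_le:
  assumes "\<bar>a\<bar> \<le> A" "\<bar>v\<bar> \<le> W"
  shows "\<bar>shifted_prod a v j\<bar> \<le> (W + A) ^ j"
proof -
  have "\<bar>shifted_prod a v j\<bar> \<le> (\<Prod>i<j. W + A)"
    unfolding shifted_prod_def abs_prod
  proof (intro prod_mono conjI)
    fix i
    show "\<bar>v + a * q ^ i\<bar> \<le> W + A"
      using abs_mult_power_q_le[OF assms(1), of i] assms(2) by linarith
  qed simp
  then show ?thesis by simp
qed

lemma shifted_prod_eq_qpoch: "v \<noteq> 0 \<Longrightarrow> shifted_prod a v j = v ^ j * qpoch (- (a / v)) q j"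
proof (induction j)
  case (Suc j)
  then show ?case
    by (simp add: shifted_prod_Suc qpoch_Suc) (simp add: field_simps)
qed simp

text \<open>\<open>bes b v x\<close> is \<open>(b;q)\<^sub>\<infinity> 1\<phi>1(- c b / v; b; q, v x)\<close> with coefficients made polynomial in \<open>v\<close>,
  so that \<open>v = 0\<close> is allowed and gives the \<open>0\<phi>1\<close>-series of the q-Bessel functions.\<close>

definition bes_coeff :: "real \<Rightarrow> real \<Rightarrow> nat \<Rightarrow> real" where
  "bes_coeff b v j =
     shifted_prod (c * b) v j * (-1) ^ j * q ^ (j choose 2) * qpoch_inf (b * q ^ j) q / qpoch q q j"

definition bes :: "real \<Rightarrow> real \<Rightarrow> real \<Rightarrow> real" where
  "bes b v x = (\<Sum>j. bes_coeff b v j * x ^ j)"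

definition bes_deriv :: "real \<Rightarrow> real \<Rightarrow> real \<Rightarrow> real" where
  "bes_deriv b v x = (\<Sum>j. diffs (bes_coeff b v) j * x ^ j)"

lemma bes_coeff_bound:
  assumes "\<bar>b\<bar> \<le> 1" "\<bar>v\<bar> \<le> W"
  shows "\<bar>bes_coeff b v j\<bar> \<le> qpoch_inf (-1) q / qpoch_inf q q * (q ^ (j choose 2) * (W + c) ^ j)"
proof -
  have W: "0 \<le> W" using assms by linarith
  have cb: "\<bar>c * b\<bar> \<le> c"
    using assms c_pos by (simp add: abs_mult)
  have "\<bar>bes_coeff b v j\<bar> = \<bar>shifted_prod (c * b) v j\<bar> * \<bar>qpoch_inf (b * q ^ j) q\<bar> *
      (1 / qpoch q q j) * q ^ (j choose 2)"
    using q_pos by (simp add: bes_coeff_def abs_mult less_imp_le)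
  also have "\<dots> \<le> (W + c) ^ j * qpoch_inf (-1) q * (1 / qpoch_inf q q) * q ^ (j choose 2)"
    using abs_shifted_prod_le[OF cb assms(2)] W c_pos assms
      abs_qpoch_inf_le[OF abs_mult_power_q_le[OF assms(1)]] qpoch_inf_ge_1[of 1]
    by (intro mult_mono mult_right_mono inverse_qpoch_qq_le)
      (auto intro!: mult_nonneg_nonneg divide_nonneg_pos less_imp_le[OF qpoch_qq_pos(1)]
        less_imp_le[OF power_q_pos])
  finally show ?thesis by (simp add: mult_ac)
qed

lemma summable_bes:
  assumes "\<bar>b\<bar> \<le> 1"
  shows "summable (\<lambda>j. bes_coeff b v j * x ^ j)"
proof (rule summable_comparison_test')
  let ?M = "qpoch_inf (-1) q / qpoch_inf q q"
  show "summable (\<lambda>j. ?M * (q ^ (j choose 2) * ((\<bar>v\<bar> + c) * \<bar>x\<bar>) ^ j))"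
    by (intro summable_mult summable_theta)
  fix j
  show "norm (bes_coeff b v j * x ^ j) \<le> ?M * (q ^ (j choose 2) * ((\<bar>v\<bar> + c) * \<bar>x\<bar>) ^ j)"
    using mult_right_mono[OF bes_coeff_bound[OF assms order.refl[of "\<bar>v\<bar>"], of j], of "\<bar>x\<bar> ^ j"]
    by (simp add: abs_mult power_abs power_mult_distrib mult_ac)
qed

lemma bes_sums: "\<bar>b\<bar> \<le> 1 \<Longrightarrow> (\<lambda>j. bes_coeff b v j * x ^ j) sums bes b v x"
  unfolding bes_def by (rule summable_sums[OF summable_bes])

lemma DERIV_bes: "\<bar>b\<bar> \<le> 1 \<Longrightarrow> (bes b v has_field_derivative bes_deriv b v x) (at x)"
  unfolding bes_def[abs_def] bes_deriv_def
  by (rule termdiffs_strong_converges_everywhere) (rule summable_bes)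

lemma bes_eq_heine: "v \<noteq> 0 \<Longrightarrow> bes b v x = heine (- (c / v)) b (x * v)"
  unfolding bes_def heine_def
proof (intro suminf_cong)
  fix j assume "v \<noteq> 0"
  then show "bes_coeff b v j * x ^ j = heine_term (- (c / v)) b (x * v) j"
    by (simp add: bes_coeff_def heine_term_def shifted_prod_eq_qpoch power_minus[of "x * v"]
        power_mult_distrib)
qed

lemma tendsto_bes_coeff: "(w \<longlongrightarrow> v) F \<Longrightarrow> ((\<lambda>n. bes_coeff b (w n) j) \<longlongrightarrow> bes_coeff b v j) F"
  unfolding bes_coeff_def shifted_prod_def by (intro tendsto_intros) auto

text \<open>Dominated convergence in the summation index: the majorants are uniform for
  \<open>v\<close> in [-1, 1], where \<open>w\<close> eventually stays.\<close>

lemma tendsto_bes: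
  assumes b: "\<bar>b\<bar> \<le> 1" and w: "w \<longlonglongrightarrow> 0"
  shows "(\<lambda>n. bes b (w n) x) \<longlonglongrightarrow> bes b 0 x"
    and "(\<lambda>n. bes_deriv b (w n) x) \<longlonglongrightarrow> bes_deriv b 0 x"
proof -
  let ?M = "qpoch_inf (-1) q / qpoch_inf q q"
  have ev: "\<forall>\<^sub>F n in sequentially. \<bar>w n\<bar> \<le> 1"
    using order_tendstoD(2)[OF tendsto_rabs[OF w], of 1] by (auto elim: eventually_mono)
  have prod_ev: "\<forall>\<^sub>F (j, n) in sequentially \<times>\<^sub>F sequentially. \<bar>w n\<bar> \<le> 1"
    using eventually_compose_filterlim[OF ev filterlim_snd] by (simp add: case_prod_unfold)
  let ?B = "\<lambda>j. ?M * (q ^ (j choose 2) * ((1 + c) * \<bar>x\<bar>) ^ j)"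
  have bd: "\<forall>\<^sub>F (j, n) in sequentially \<times>\<^sub>F sequentially. norm (bes_coeff b (w n) j * x ^ j) \<le> ?B j"
    using prod_ev
  proof (rule eventually_mono, safe)
    fix j n assume "\<bar>w n\<bar> \<le> 1"
    from mult_right_mono[OF bes_coeff_bound[OF b this, of j], of "\<bar>x\<bar> ^ j"]
    show "norm (bes_coeff b (w n) j * x ^ j) \<le> ?B j"
      by (simp add: abs_mult power_abs power_mult_distrib mult_ac)
  qed
  have "(\<lambda>n. bes_coeff b (w n) j * x ^ j) \<longlonglongrightarrow> bes_coeff b 0 j * x ^ j" for j
    by (intro tendsto_mult_right tendsto_bes_coeff w)
  from tannerys_theorem[OF this bd summable_mult[OF summable_theta] trivial_limit_sequentially]
  show "(\<lambda>n. bes b (w n) x) \<longlonglongrightarrow> bes b 0 x"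
    unfolding bes_def by blast
  \<comment> \<open>The factor j + 1 produced by differentiation is absorbed by 2^j, hence the 2 in
    the base.\<close>
  let ?B' = "\<lambda>j. ?M * (1 + c) * (q ^ (j choose 2) * (2 * (1 + c) * \<bar>x\<bar>) ^ j)"
  have bd: "\<forall>\<^sub>F (j, n) in sequentially \<times>\<^sub>F sequentially. norm (diffs (bes_coeff b (w n)) j * x ^ j) \<le> ?B' j"
    using prod_ev
  proof (rule eventually_mono, safe)
    fix j n assume w1: "\<bar>w n\<bar> \<le> 1"
    have M: "0 \<le> ?M" using qpoch_inf_ge_1[of 1] by (simp add: less_imp_le)
    have "real (Suc j) \<le> 2 ^ j"
      using less_exp[of j] by (metis Suc_leI numeral_power_eq_of_nat_cancel_iff of_nat_le_iff of_nat_numeral of_nat_power)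
    moreover have "\<bar>bes_coeff b (w n) (Suc j)\<bar> \<le> ?M * (q ^ (j choose 2) * (1 + c) ^ Suc j)"
    proof (rule order.trans[OF bes_coeff_bound[OF b w1]], intro mult_left_mono mult_right_mono M)
      show "q ^ (Suc j choose 2) \<le> q ^ (j choose 2)"
        using q_pos q_less by (intro power_decreasing) (auto simp: choose_two_Suc)
    qed (use c_pos in auto)
    ultimately have "real (Suc j) * \<bar>bes_coeff b (w n) (Suc j)\<bar> * \<bar>x\<bar> ^ j
        \<le> 2 ^ j * (?M * (q ^ (j choose 2) * (1 + c) ^ Suc j)) * \<bar>x\<bar> ^ j"
      by (intro mult_right_mono mult_mono) auto
    also have "\<dots> = ?B' j"
      by (simp only: power_mult_distrib power_Suc mult_ac)
    finally show "norm (diffs (bes_coeff b (w n)) j * x ^ j) \<le> ?B' j"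
      by (simp only: diffs_def real_norm_def abs_mult power_abs abs_of_nat)
  qed
  have "(\<lambda>n. diffs (bes_coeff b (w n)) j * x ^ j) \<longlonglongrightarrow> diffs (bes_coeff b 0) j * x ^ j" for j
    unfolding diffs_def by (intro tendsto_mult_right tendsto_mult_left tendsto_bes_coeff w)
  from tannerys_theorem[OF this bd summable_mult[OF summable_theta] trivial_limit_sequentially]
  show "(\<lambda>n. bes_deriv b (w n) x) \<longlonglongrightarrow> bes_deriv b 0 x"
    unfolding bes_deriv_def by blast
qed

section \<open>Contiguous relations for \<open>bes\<close>\<close>

lemma bes_shift:
  assumes "\<bar>b\<bar> \<le> 1"
  shows "bes b v x = bes b (v * q) x - v * x * bes (b * q) (v * q) x"
proof -
  have step: "bes_coeff b v (Suc j) * x ^ Suc j - bes_coeff b (v * q) (Suc j) * x ^ Suc j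
      = - v * x * (bes_coeff (b * q) (v * q) j * x ^ j)" for j
  proof -
    define e where "e = 1 - q ^ Suc j"
    have Q: "qpoch q q (Suc j) = qpoch q q j * e"
      by (simp add: qpoch_Suc e_def)
    then have e: "e \<noteq> 0"
      using qpoch_qq_ne(1)[of "Suc j"] by auto
    define S where "S = shifted_prod (c * b) v j"
    have S: "shifted_prod (c * b) v (Suc j) = S * (v + c * b * q ^ j)"
      "shifted_prod (c * b) (v * q) (Suc j) = (v * q + c * b) * (q ^ j * S)"
      "shifted_prod (c * (b * q)) (v * q) j = q ^ j * S"
      by (simp_all only: S_def shifted_prod_Suc)
        (simp_all add: shifted_prod_scale shifted_prod_Suc_left flip: mult.assoc shifted_prod_Suc)
    define X where "X = S * (-1) ^ Suc j * q ^ (j choose 2) * q ^ j * qpoch_inf (b * q ^ Suc j) q * x ^ Suc j"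
    have "bes_coeff b v (Suc j) * x ^ Suc j = X / (qpoch q q j * e) * (v + c * b * q ^ j)"
      "bes_coeff b (v * q) (Suc j) * x ^ Suc j = X / (qpoch q q j * e) * ((v * q + c * b) * q ^ j)"
      by (simp_all add: bes_coeff_def S Q X_def choose_two_Suc power_add)
    then have "bes_coeff b v (Suc j) * x ^ Suc j - bes_coeff b (v * q) (Suc j) * x ^ Suc j
        = X / (qpoch q q j * e) * ((v + c * b * q ^ j) - (v * q + c * b) * q ^ j)"
      by (simp only: right_diff_distrib)
    \<comment> \<open>The terms with c b cancel, and the surviving 1 - q^(j+1) lowers the
      index.\<close>
    also have "(v + c * b * q ^ j) - (v * q + c * b) * q ^ j = v * e"
      by (simp add: e_def algebra_simps)
    also have "X / (qpoch q q j * e) * (v * e) = X / qpoch q q j * v"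
      using e by simp
    also have "\<dots> = - v * x * (bes_coeff (b * q) (v * q) j * x ^ j)"
      unfolding bes_coeff_def S X_def by (simp add: mult_ac)
    finally show ?thesis .
  qed
  have bq: "\<bar>b * q\<bar> \<le> 1"
    using abs_mult_power_q_le[OF assms, of 1] by simp
  have "(\<lambda>j. bes_coeff b v j * x ^ j - bes_coeff b (v * q) j * x ^ j)
      sums (bes b v x - bes b (v * q) x)"
    by (intro sums_diff bes_sums assms)
  then have "(\<lambda>j. - v * x * (bes_coeff (b * q) (v * q) j * x ^ j))
      sums (bes b v x - bes b (v * q) x)"
    unfolding step[symmetric] by (subst sums_Suc_iff) (simp add: bes_coeff_def)
  moreover have "(\<lambda>j. - v * x * (bes_coeff (b * q) (v * q) j * x ^ j))
      sums (- v * x * bes (b * q) (v * q) x)"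
    by (intro sums_mult bes_sums bq)
  ultimately have "bes b v x - bes b (v * q) x = - v * x * bes (b * q) (v * q) x"
    by (rule sums_unique2)
  then show ?thesis by linarith
qed

text \<open>With \<open>bes_shift\<close> this forms a closed first-order system for the parameters
  \<open>b\<close> and \<open>b * q\<close>. It holds term by term: the right-hand combination
  produces 1 - b q^j, the factor by which the infinite products at \<open>b\<close> and
  \<open>b * q\<close> differ.\<close>

lemma bes_raise:
  assumes "\<bar>b\<bar> \<le> 1"
  shows "v * bes b v x = (v + c * b) * bes (b * q) v x - b * (c + v) * bes (b * q) (v * q) x"
proof -
  have step: "(v + c * b) * (bes_coeff (b * q) v j * x ^ j) - b * (c + v) * (bes_coeff (b * q) (v * q) j * x ^ j)
      = v * (bes_coeff b v j * x ^ j)" for j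
  proof -
    define S where "S = shifted_prod (c * b) v j"
    have S: "(v + c * b) * shifted_prod (c * (b * q)) v j = S * (v + c * b * q ^ j)"
      "shifted_prod (c * (b * q)) (v * q) j = q ^ j * S"
      by (simp_all add: S_def shifted_prod_scale flip: mult.assoc shifted_prod_Suc shifted_prod_Suc_left)
    define X where "X = (-1) ^ j * q ^ (j choose 2) * qpoch_inf (b * q * q ^ j) q / qpoch q q j * x ^ j"
    have "(v + c * b) * (bes_coeff (b * q) v j * x ^ j) - b * (c + v) * (bes_coeff (b * q) (v * q) j * x ^ j)
       = ((v + c * b) * shifted_prod (c * (b * q)) v j
          - b * (c + v) * shifted_prod (c * (b * q)) (v * q) j) * X"
      by (simp add: bes_coeff_def X_def algebra_simps)
    also have "\<dots> = v * S * (1 - b * q ^ j) * X"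
      unfolding S by (simp add: algebra_simps)
    also have "\<dots> = v * (bes_coeff b v j * x ^ j)"
      unfolding bes_coeff_def X_def S_def
      by (subst qpoch_inf_rec[of "b * q ^ j"]) (simp add: mult_ac)
    finally show ?thesis .
  qed
  have bq: "\<bar>b * q\<bar> \<le> 1"
    using abs_mult_power_q_le[OF assms, of 1] by simp
  have "(\<lambda>j. v * (bes_coeff b v j * x ^ j)) sums
      ((v + c * b) * bes (b * q) v x - b * (c + v) * bes (b * q) (v * q) x)"
    unfolding step[symmetric] by (intro sums_diff sums_mult bes_sums bq)
  moreover have "(\<lambda>j. v * (bes_coeff b v j * x ^ j)) sums (v * bes b v x)"
    by (intro sums_mult bes_sums assms)
  ultimately show ?thesis
    using sums_unique2 by blast
qed

section \<open>Asymptotics of \<open>bes\<close> and its derivative for large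
  \<open>v\<close>\<close>

definition sym_term :: "real \<Rightarrow> real \<Rightarrow> real \<Rightarrow> nat \<Rightarrow> real" where
  "sym_term b v y N =
     qpoch (- (c * y)) q N / qpoch q q N * (- b) ^ N * q ^ (N choose 2) * qpoch_inf (y * v * q ^ N) q"

text \<open>The symmetry turns the parameter of the finite product into - c y, which is free of
  \<open>v\<close>. All dependence on \<open>v\<close> is confined to one infinite product.\<close>

lemma sym_term_sums: "v \<noteq> 0 \<Longrightarrow> sym_term b v y sums bes b v y"
proof -
  assume v: "v \<noteq> 0"
  have "heine_term (- (c / v)) (y * v) b = sym_term b v y"
    using v by (simp add: fun_eq_iff heine_term_def sym_term_def)
  then show ?thesis
    using summable_sums[OF summable_heine_term, of "- (c / v)" "y * v" b]
    unfolding bes_eq_heine[OF v] heine_sym[of "- (c / v)" b "y * v"]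
    unfolding heine_def by simp
qed

lemma qpoch_quotient_bound:
  assumes "0 \<le> R"
  shows "\<bar>qpoch (- R) q m / qpoch q q n\<bar> \<le> qpoch_inf (- R) q / qpoch_inf q q"
proof -
  have "qpoch (- R) q m * (1 / qpoch q q n) \<le> qpoch_inf (- R) q * (1 / qpoch_inf q q)"
    using qpoch_ge_1[OF assms, of m] qpoch_inf_ge_1[OF assms] assms
    by (intro mult_mono qpoch_le_inf inverse_qpoch_qq_le) (auto simp: less_imp_le)
  moreover have "0 \<le> qpoch (- R) q m / qpoch q q n"
    using qpoch_ge_1[OF assms, of m] by (simp add: less_imp_le)
  ultimately show ?thesis by simp
qed

text \<open>For N = r + K + 1 the product starts at (y / x) q^(r+1), independently of
  \<open>K\<close>. The factor pulled out in front is the decay rate.\<close>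

lemma tail_term:
  assumes "0 < x"
  shows "sym_term b (1 / (q ^ K * x)) y (r + Suc K)
    = (- b) ^ Suc K * q ^ (Suc K choose 2) *
      (qpoch (- (c * y)) q (r + Suc K) / qpoch q q (r + Suc K) * (- b) ^ r * q ^ (r choose 2)
        * (q ^ Suc K) ^ r * qpoch_inf (y / x * q ^ Suc r) q)"
proof -
  have "y * (1 / (q ^ K * x)) * q ^ (r + Suc K) = y / x * q ^ Suc r"
    using assms by (simp add: power_add field_simps)
  then show ?thesis
    unfolding sym_term_def choose_two_add
    by (simp only: power_add power_mult[symmetric] mult_ac)
qed

text \<open>Once the decay rate is divided out, the remaining term with index r carries
  \<open>(q ^ Suc K) ^ r\<close>, so only r = 0 survives in the limit. There (q;q) infinity occurs
  in the numerator and in the denominator and cancels.\<close>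

lemma bes_asym:
  assumes b: "0 < b" "b < 1" and x: "0 < x"
  shows "(\<lambda>K. bes b (1 / (q ^ K * x)) x / ((- b) ^ Suc K * q ^ (Suc K choose 2)))
     \<longlonglongrightarrow> qpoch_inf (- (c * x)) q"
proof -
  define t where "t r K = qpoch (- (c * x)) q (r + Suc K) / qpoch q q (r + Suc K) * (- b) ^ r
    * q ^ (r choose 2) * (q ^ Suc K) ^ r * qpoch_inf (q ^ Suc r) q" for r K
  have cx: "0 \<le> c * x" using c_pos x by simp
  have eq: "bes b (1 / (q ^ K * x)) x / ((- b) ^ Suc K * q ^ (Suc K choose 2)) = (\<Sum>r. t r K)" for K
  proof -
    let ?v = "1 / (q ^ K * x)"
    have v: "?v \<noteq> 0" using x by simp
    have "sym_term b ?v x N = 0" if "N < Suc K" for N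
    proof -
      have "x * ?v * q ^ N * q ^ (K - N) = 1"
        using that x by (simp flip: power_add)
      then show ?thesis by (simp add: sym_term_def qpoch_inf_eq_0)
    qed
    then have "(\<lambda>r. sym_term b ?v x (r + Suc K)) sums bes b ?v x"
      using sums_split_initial_segment[OF sym_term_sums[OF v], of b x "Suc K"] by simp
    then have "(\<lambda>r. (- b) ^ Suc K * q ^ (Suc K choose 2) * t r K) sums bes b ?v x"
      using x by (simp only: tail_term t_def) simp
    from sums_divide[OF this, of "(- b) ^ Suc K * q ^ (Suc K choose 2)"]
    have "(\<lambda>r. t r K) sums (bes b ?v x / ((- b) ^ Suc K * q ^ (Suc K choose 2)))"
      using b by simp
    then show ?thesis by (simp add: sums_iff)
  qed
  have lim: "(\<lambda>K. t r K) \<longlonglongrightarrow> (if r = 0 then qpoch_inf (- (c * x)) q else 0)" for r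
  proof -
    have sh: "(\<lambda>K. qpoch a q (r + Suc K)) \<longlonglongrightarrow> qpoch_inf a q" for a
      using LIMSEQ_ignore_initial_segment[OF qpoch_tendsto[of a], of "Suc r"] by (simp add: add_ac)
    have "(\<lambda>K. (q ^ Suc K) ^ r) \<longlonglongrightarrow> 0 ^ r"
      using q_pos q_less by (intro tendsto_power LIMSEQ_Suc LIMSEQ_realpow_zero) auto
    then have "(\<lambda>K. t r K) \<longlonglongrightarrow> qpoch_inf (- (c * x)) q / qpoch_inf q q * (- b) ^ r
      * q ^ (r choose 2) * 0 ^ r * qpoch_inf (q ^ Suc r) q"
      unfolding t_def by (intro tendsto_mult tendsto_divide sh tendsto_const) auto
    then show ?thesis by (cases r) auto
  qed
  have bd: "norm (t r K) \<le> qpoch_inf (- (c * x)) q / qpoch_inf q q * qpoch_inf (-1) q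
      * (q ^ (r choose 2) * b ^ r)" for r K
  proof -
    have "norm (t r K) = \<bar>qpoch (- (c * x)) q (r + Suc K) / qpoch q q (r + Suc K)\<bar>
        * \<bar>qpoch_inf (q ^ Suc r) q\<bar> * (q ^ (r choose 2) * b ^ r) * (q ^ Suc K) ^ r"
      using b q_pos by (simp add: t_def abs_mult power_abs)
    also have "\<dots> \<le> qpoch_inf (- (c * x)) q / qpoch_inf q q * qpoch_inf (-1) q
      * (q ^ (r choose 2) * b ^ r) * 1"
      using b q_pos q_less cx qpoch_inf_ge_1[OF cx] qpoch_inf_ge_1[of 1] power_q_le
      by (intro mult_mono qpoch_quotient_bound abs_qpoch_inf_le power_le_one)
        (auto intro!: mult_nonneg_nonneg divide_nonneg_pos simp del: power_Suc)
    finally show ?thesis by simp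
  qed
  have "(\<lambda>K. \<Sum>r. t r K) \<longlonglongrightarrow> (\<Sum>r. if r = 0 then qpoch_inf (- (c * x)) q else 0)"
  proof -
    have "\<forall>\<^sub>F (r, K) in sequentially \<times>\<^sub>F sequentially. norm (t r K)
        \<le> qpoch_inf (- (c * x)) q / qpoch_inf q q * qpoch_inf (-1) q * (q ^ (r choose 2) * b ^ r)"
      using bd by (intro always_eventually) blast
    from tannerys_theorem[OF lim this summable_mult[OF summable_theta] trivial_limit_sequentially]
    show ?thesis by blast
  qed
  also have "(\<Sum>r. if r = 0 then qpoch_inf (- (c * x)) q else 0) = qpoch_inf (- (c * x)) q"
    using sums_single[of 0 "\<lambda>_. qpoch_inf (- (c * x)) q"] by (simp add: sums_iff)
  finally show ?thesis unfolding eq .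
qed

lemma qpoch_reverse: "qpoch (1 / q ^ n) q n = (-1) ^ n / q ^ (Suc n choose 2) * qpoch q q n"
proof (induction n)
  case (Suc n)
  have "qpoch (1 / q ^ Suc n) q (Suc n) = (1 - 1 / q ^ Suc n) * qpoch (1 / q ^ n) q n"
    by (simp add: qpoch_Suc_left)
  also have "1 - 1 / q ^ Suc n = - (1 / q ^ Suc n) * (1 - q * q ^ n)"
    by (simp add: field_simps)
  finally show ?case
    using Suc by (simp add: qpoch_Suc choose_two_Suc[of "Suc n"] power_add mult_ac)
qed (simp add: choose_two)

definition tail_series :: "real \<Rightarrow> real \<Rightarrow> nat \<Rightarrow> real \<Rightarrow> real" where
  "tail_series b x K y = (\<Sum>r. sym_term b (1 / (q ^ K * x)) y (r + Suc K))"

text \<open>What matters is that \<open>L\<close> is independent of \<open>K\<close>. The variable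
  \<open>y\<close> enters only through a finite product at - c y and an infinite one at (y / x)
  q^(r+1), both Lipschitz uniformly in their indices.\<close>

lemma tail_lipschitz:
  assumes b: "0 < b" "b < 1" and x: "0 < x"
  obtains L where "\<And>K y. \<bar>y - x\<bar> < x \<Longrightarrow> \<bar>tail_series b x K y - tail_series b x K x\<bar> \<le> L * \<bar>y - x\<bar>"
proof -
  \<comment> \<open>Since 0 < y < 2 x, this bounds c y as well as y / x.\<close>
  define R where "R = 2 * c * x + 2"
  define M where "M = qpoch_inf (- R) q"
  define L0 where "L0 = M / (1 - q) * c * M + M * (M / (1 - q) * (1 / x))"
  have R: "0 \<le> R" "2 \<le> R" "2 * (c * x) \<le> R" using c_pos x by (auto simp: R_def)
  have M: "1 \<le> M" unfolding M_def by (rule qpoch_inf_ge_1) fact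
  have L0: "0 \<le> L0" using M c_pos x q_less by (simp add: L0_def)
  have prod: "\<bar>qpoch (- (c * y)) q N * qpoch_inf (y / x * q ^ m) q
      - qpoch (- (c * x)) q N * qpoch_inf (x / x * q ^ m) q\<bar> \<le> L0 * \<bar>y - x\<bar>"
    if "\<bar>y - x\<bar> < x" for y N m
  proof -
    have y: "\<bar>y\<bar> \<le> 2 * x" using that x by linarith
    have "c * \<bar>y\<bar> \<le> 2 * (c * x)" "0 \<le> c * x"
      using c_pos x mult_left_mono[OF y, of c] by (auto simp: mult_ac)
    then have "c * \<bar>y\<bar> \<le> R" "c * x \<le> R"
      using R(3) by linarith+
    then have cy: "\<bar>- (c * y)\<bar> \<le> R" "\<bar>- (c * x)\<bar> \<le> R"
      using c_pos x by (simp_all add: abs_mult)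
    have yx: "\<bar>y / x * q ^ m\<bar> \<le> R" "\<bar>x / x * q ^ m\<bar> \<le> R"
    proof -
      have "\<bar>y / x\<bar> \<le> 2" "\<bar>x / x\<bar> \<le> 2"
        using y x by (auto simp: divide_le_eq)
      from this[THEN abs_mult_power_q_le[of _ 2 m]] show "\<bar>y / x * q ^ m\<bar> \<le> R" "\<bar>x / x * q ^ m\<bar> \<le> R"
        using R(2) by linarith+
    qed
    let ?A = "\<lambda>y. qpoch (- (c * y)) q N" and ?B = "\<lambda>y. qpoch_inf (y / x * q ^ m) q"
    have A: "\<bar>?A y - ?A x\<bar> \<le> M / (1 - q) * (c * \<bar>y - x\<bar>)"
      using qpoch_lipschitz[OF cy, of N] c_pos
      by (simp add: M_def abs_mult abs_minus_commute flip: right_diff_distrib)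
    have B: "\<bar>?B y - ?B x\<bar> \<le> M / (1 - q) * (1 / x * \<bar>y - x\<bar>)"
    proof -
      have "\<bar>y / x * q ^ m - x / x * q ^ m\<bar> = 1 / x * \<bar>y - x\<bar> * q ^ m"
      proof -
        have "y / x * q ^ m - x / x * q ^ m = 1 / x * (y - x) * q ^ m"
          by (simp add: diff_divide_distrib left_diff_distrib)
        then show ?thesis using x q_pos by (simp add: abs_mult)
      qed
      also have "\<dots> \<le> 1 / x * \<bar>y - x\<bar> * 1"
        using x by (intro mult_left_mono) auto
      finally have "M / (1 - q) * \<bar>y / x * q ^ m - x / x * q ^ m\<bar> \<le> M / (1 - q) * (1 / x * \<bar>y - x\<bar>)"
        using M q_less by (intro mult_left_mono) auto
      then show ?thesis
        using qpoch_inf_lipschitz[OF yx] unfolding M_def by linarith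
    qed
    have "?A y * ?B y - ?A x * ?B x = (?A y - ?A x) * ?B y + ?A x * (?B y - ?B x)"
      by (simp add: algebra_simps)
    then have "\<bar>?A y * ?B y - ?A x * ?B x\<bar> \<le> \<bar>?A y - ?A x\<bar> * \<bar>?B y\<bar> + \<bar>?A x\<bar> * \<bar>?B y - ?B x\<bar>"
      by (metis abs_mult abs_triangle_ineq)
    also have "\<dots> \<le> (M / (1 - q) * (c * \<bar>y - x\<bar>)) * M + M * (M / (1 - q) * (1 / x * \<bar>y - x\<bar>))"
      using M c_pos q_less x
      by (intro add_mono mult_mono A B) (use abs_qpoch_inf_le[OF yx(1)] abs_qpoch_le[OF cy(2)] in \<open>auto simp: M_def\<close>)
    also have "\<dots> = L0 * \<bar>y - x\<bar>"
      by (simp add: L0_def algebra_simps)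
    finally show ?thesis .
  qed
  have bound: "\<bar>sym_term b (1 / (q ^ K * x)) y (r + Suc K) - sym_term b (1 / (q ^ K * x)) x (r + Suc K)\<bar>
     \<le> L0 / qpoch_inf q q * \<bar>y - x\<bar> * (q ^ (r choose 2) * b ^ r)" if "\<bar>y - x\<bar> < x" for y K r
  proof -
    let ?N = "r + Suc K"
    have v: "y * (1 / (q ^ K * x)) * q ^ ?N = y / x * q ^ Suc r" for y
      using x by (simp add: power_add field_simps)
    have "sym_term b (1 / (q ^ K * x)) y ?N = (qpoch (- (c * y)) q ?N * qpoch_inf (y / x * q ^ Suc r) q)
        * (1 / qpoch q q ?N) * ((- b) ^ ?N * q ^ (?N choose 2))" for y
      unfolding sym_term_def v by (simp del: power_Suc)
    then have "sym_term b (1 / (q ^ K * x)) y ?N - sym_term b (1 / (q ^ K * x)) x ?N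
      = (qpoch (- (c * y)) q ?N * qpoch_inf (y / x * q ^ Suc r) q
      - qpoch (- (c * x)) q ?N * qpoch_inf (x / x * q ^ Suc r) q) * (1 / qpoch q q ?N) *
         ((- b) ^ ?N * q ^ (?N choose 2))"
      by (simp only: left_diff_distrib)
    also have "\<bar>\<dots>\<bar> = \<bar>qpoch (- (c * y)) q ?N * qpoch_inf (y / x * q ^ Suc r) q
      - qpoch (- (c * x)) q ?N * qpoch_inf (x / x * q ^ Suc r) q\<bar> * (1 / qpoch q q ?N) *
         (q ^ (?N choose 2) * b ^ ?N)"
      using b q_pos by (simp add: abs_mult power_abs less_imp_le)
    also have "\<dots> \<le> (L0 * \<bar>y - x\<bar>) * (1 / qpoch_inf q q) * (q ^ (r choose 2) * b ^ r)"
    proof (intro mult_mono prod[OF that] inverse_qpoch_qq_le)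
      show "q ^ (?N choose 2) \<le> q ^ (r choose 2)"
        using q_pos q_less choose_two_add[of r "Suc K"] by (intro power_decreasing) linarith+
      show "b ^ ?N \<le> b ^ r"
        using b by (intro power_decreasing) auto
      show "0 \<le> 1 / qpoch q q ?N"
        using qpoch_qq_pos(1)[of ?N] by (simp add: less_imp_le)
    qed (use b q_pos L0 in \<open>auto intro!: divide_nonneg_pos\<close>)
    finally show ?thesis by simp
  qed
  define L where "L = L0 / qpoch_inf q q * (\<Sum>r. q ^ (r choose 2) * b ^ r)"
  have "\<bar>tail_series b x K y - tail_series b x K x\<bar> \<le> L * \<bar>y - x\<bar>" if "\<bar>y - x\<bar> < x" for K y
  proof -
    have v: "1 / (q ^ K * x) \<noteq> 0" using x by simp
    let ?d = "\<lambda>r. sym_term b (1 / (q ^ K * x)) y (r + Suc K) - sym_term b (1 / (q ^ K * x)) x (r + Suc K)"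
    let ?m = "\<lambda>r. L0 / qpoch_inf q q * \<bar>y - x\<bar> * (q ^ (r choose 2) * b ^ r)"
    have sm: "summable (\<lambda>r. sym_term b (1 / (q ^ K * x)) y (r + Suc K))" for y
      using summable_ignore_initial_segment[OF sums_summable[OF sym_term_sums[OF v]]] .
    have smm: "summable ?m" by (intro summable_mult summable_theta)
    have sma: "summable (\<lambda>r. norm (?d r))"
      using smm by (rule summable_comparison_test'[of _ 0]) (use bound[OF that] in simp)
    have "\<bar>tail_series b x K y - tail_series b x K x\<bar> = norm (\<Sum>r. ?d r)"
      unfolding tail_series_def using suminf_diff[OF sm sm] by simp
    also have "\<dots> \<le> (\<Sum>r. ?m r)"
      by (rule order.trans[OF summable_norm[OF sma] suminf_le[OF _ sma smm]])
        (unfold real_norm_def, rule bound[OF that])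
    also have "\<dots> = L * \<bar>y - x\<bar>"
      by (subst suminf_mult[OF summable_theta]) (simp add: L_def)
    finally show ?thesis .
  qed
  then show ?thesis by (rule that)
qed

text \<open>In the transformed series the terms up to \<open>K\<close> contain the factor \<open>1 - y / x\<close>, so differentiating at
  \<open>y = x\<close> just removes it; the remaining terms are Lipschitz uniformly in \<open>K\<close> and do not contribute.\<close>

lemma bes_deriv_asym:
  assumes b: "0 < b" "b < 1" and x: "0 < x"
  shows "(\<lambda>K. x * bes_deriv b (1 / (q ^ K * x)) x * ((-1) ^ K * q ^ (Suc K choose 2)))
     \<longlonglongrightarrow> - (qpoch_inf q q)\<^sup>2"
proof -
  let ?Q = "qpoch_inf q q"
  \<comment> \<open>By \<open>S_x\<close> below, this is the term with index \<open>N\<close> at y =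
    x, stripped of its vanishing factor and rescaled by the expected growth rate.\<close>
  define t where "t N K = (if N \<le> K then qpoch (- (c * x)) q N / qpoch q q N * b ^ N * (q ^ K) ^ N
      * (qpoch q q (K - N) * ?Q) else 0)" for N K
  have cx: "0 \<le> c * x" using c_pos x by simp
  obtain L where L: "\<And>K y. \<bar>y - x\<bar> < x \<Longrightarrow> \<bar>tail_series b x K y - tail_series b x K x\<bar> \<le> L * \<bar>y - x\<bar>"
    using tail_lipschitz[OF assms] by blast
  \<comment> \<open>The infinite product of the transformed term starts at (y / x) q^(N - K); its
    factor with index K - N is 1 - y / x, and \<open>S\<close> keeps all the others.\<close>
  define S where "S K N y = qpoch (- (c * y)) q N / qpoch q q N * (- b) ^ N * q ^ (N choose 2) *
      (qpoch (y / x * (1 / q ^ (K - N))) q (K - N) * qpoch_inf (y / x * q) q)" for K N y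
  have S_eq: "sym_term b (1 / (q ^ K * x)) y N = (1 - y / x) * S K N y" if "N \<le> K" for K N y
  proof -
    let ?a = "y / x * (1 / q ^ (K - N))"
    have "q ^ K = q ^ (K - N) * q ^ N" using that by (simp flip: power_add)
    then have a: "y * (1 / (q ^ K * x)) * q ^ N = ?a"
      using x by (simp add: field_simps)
    have a': "?a * q ^ (K - N) = y / x" by simp
    have "qpoch_inf ?a q = qpoch ?a q (K - N) * ((1 - y / x) * qpoch_inf (y / x * q) q)"
      by (subst qpoch_inf_split[of _ "K - N"], subst qpoch_inf_rec[of "?a * q ^ (K - N)"]) (simp only: a')
    then show ?thesis
      unfolding sym_term_def S_def a by (simp only: mult_ac)
  qed
  have S_x: "(-1) ^ K * q ^ (Suc K choose 2) * S K N x = t N K" if "N \<le> K" for K N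
  proof -
    from le_Suc_ex[OF that] obtain n where K: "K = N + n" by blast
    have e1: "Suc (N + n) choose 2 = (N choose 2) + (Suc n choose 2) + N * Suc n"
      using choose_two_add[of N "Suc n"] by simp
    have "2 * (N choose 2) + N * Suc n = (N + n) * N"
      unfolding double_choose_two by (cases N) (auto simp: algebra_simps)
    then have e2: "q ^ (N choose 2) * q ^ (N choose 2) * q ^ (N * Suc n) = (q ^ (N + n)) ^ N"
      by (simp flip: power_add power_mult add: mult_2)
    have "(-1::real) ^ (N + n) * (- b) ^ N * (-1) ^ n = ((-1) * (- b)) ^ N * ((-1) * (-1)) ^ n"
      by (simp only: power_mult_distrib power_add mult_ac)
    then have s: "(-1::real) ^ (N + n) * (- b) ^ N * (-1) ^ n = b ^ N"
      by simp
    have "(-1) ^ K * q ^ (Suc K choose 2) * S K N x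
      = (qpoch (- (c * x)) q N / qpoch q q N) * ((-1) ^ (N + n) * (- b) ^ N * (-1) ^ n)
        * (q ^ (N choose 2) * q ^ (N choose 2) * q ^ (N * Suc n))
        * (q ^ (Suc n choose 2) / q ^ (Suc n choose 2)) * (qpoch q q n * ?Q)"
      using x unfolding S_def K e1 by (simp add: qpoch_reverse power_add)
    also have "\<dots> = t N K"
      unfolding e2 s using K by (simp add: t_def)
    finally show ?thesis .
  qed
  have main: "\<bar>x * bes_deriv b (1 / (q ^ K * x)) x * ((-1) ^ K * q ^ (Suc K choose 2)) + (\<Sum>N. t N K)\<bar>
      \<le> x * L * q ^ (Suc K choose 2)" for K
  proof -
    let ?v = "1 / (q ^ K * x)" and ?w = "(-1) ^ K * q ^ (Suc K choose 2)"
    have v: "?v \<noteq> 0" using x by simp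
    have split: "bes b ?v y = tail_series b x K y + (\<Sum>N<Suc K. sym_term b ?v y N)" for y
      using suminf_split_initial_segment[OF sums_summable[OF sym_term_sums[OF v]], of b y "Suc K"]
        sums_unique[OF sym_term_sums[OF v], of b y]
      by (simp add: tail_series_def)
    have "((\<lambda>y. \<Sum>N<Suc K. sym_term b ?v y N) has_field_derivative (\<Sum>N<Suc K. - (1 / x) * S K N x)) (at x)"
    proof (rule DERIV_sum)
      fix N assume "N \<in> {..<Suc K}"
      then have eq: "(\<lambda>y. sym_term b ?v y N) = (\<lambda>y. (1 - y / x) * S K N y)"
        using S_eq by (simp add: fun_eq_iff)
      \<comment> \<open>Because 1 - y / x vanishes at \<open>x\<close>, continuity of
        \<open>S\<close> already yields the derivative of the product.\<close>
      have "isCont (S K N) x"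
        unfolding S_def[abs_def] isCont_def
        by (intro tendsto_intros tendsto_qpoch tendsto_qpoch_inf) (use x in auto)
      then have "((\<lambda>y. - (1 / x) * S K N y) \<longlongrightarrow> - (1 / x) * S K N x) (at x)"
        by (intro tendsto_mult_left) (simp add: isCont_def)
      moreover have "\<forall>\<^sub>F y in at x. - (1 / x) * S K N y
          = ((1 - y / x) * S K N y - (1 - x / x) * S K N x) / (y - x)"
        unfolding eventually_at_filter
        using x by (intro always_eventually) (auto simp: divide_simps, auto simp: algebra_simps)
      ultimately show "((\<lambda>y. sym_term b ?v y N) has_field_derivative - (1 / x) * S K N x) (at x)"
        unfolding eq has_field_derivative_iff
        by (rule Lim_transform_eventually)
    qed
    then have "((\<lambda>y. bes b ?v y - (\<Sum>N<Suc K. sym_term b ?v y N)) has_field_derivative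
        bes_deriv b ?v x - (\<Sum>N<Suc K. - (1 / x) * S K N x)) (at x)"
      using b by (intro DERIV_diff DERIV_bes) auto
    then have "(tail_series b x K has_field_derivative
        bes_deriv b ?v x - (\<Sum>N<Suc K. - (1 / x) * S K N x)) (at x)"
      unfolding split by simp
    then have "\<bar>bes_deriv b ?v x - (\<Sum>N<Suc K. - (1 / x) * S K N x)\<bar> \<le> L"
      using L by (rule abs_DERIV_le_lipschitz[OF _ x])
    then have i1: "\<bar>x * ?w\<bar> * \<bar>bes_deriv b ?v x - (\<Sum>N<Suc K. - (1 / x) * S K N x)\<bar>
        \<le> \<bar>x * ?w\<bar> * L"
      by (intro mult_left_mono) auto
    have i2: "\<bar>x * ?w\<bar> = x * q ^ (Suc K choose 2)"
      using x q_pos by (simp add: abs_mult power_abs)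
    have i3: "x * ?w * (bes_deriv b ?v x - (\<Sum>N<Suc K. - (1 / x) * S K N x))
        = x * bes_deriv b ?v x * ?w + (\<Sum>N<Suc K. ?w * S K N x)"
    proof -
      have "x * ?w * (\<Sum>N<Suc K. - (1 / x) * S K N x) = - (\<Sum>N<Suc K. ?w * S K N x)"
        unfolding sum_distrib_left sum_negf[symmetric] by (intro sum.cong) (use x in auto)
      then show ?thesis unfolding right_diff_distrib by (simp only: mult_ac diff_minus_eq_add)
    qed
    have i4: "(\<Sum>N<Suc K. ?w * S K N x) = (\<Sum>N. t N K)"
    proof -
      have "(\<Sum>N<Suc K. ?w * S K N x) = (\<Sum>N<Suc K. t N K)"
        by (intro sum.cong refl S_x) auto
      also have "\<dots> = (\<Sum>N. t N K)"
        by (rule suminf_finite[symmetric]) (auto simp: t_def)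
      finally show ?thesis .
    qed
    show ?thesis
      using i1 unfolding abs_mult[symmetric] i3 i4 unfolding i2 by (simp only: mult_ac)
  qed
  have "(\<lambda>K. \<Sum>N. t N K) \<longlonglongrightarrow> (\<Sum>N. if N = 0 then ?Q\<^sup>2 else 0)"
  proof -
    have lim: "(\<lambda>K. t N K) \<longlonglongrightarrow> (if N = 0 then ?Q\<^sup>2 else 0)" for N
    proof -
      have "(\<lambda>K. (q ^ K) ^ N) \<longlonglongrightarrow> 0 ^ N"
        using q_pos q_less by (intro tendsto_power LIMSEQ_realpow_zero) auto
      moreover have "(\<lambda>K. qpoch q q (K - N)) \<longlonglongrightarrow> ?Q"
        by (rule LIMSEQ_offset[of _ N]) (simp add: qpoch_tendsto)
      ultimately have "(\<lambda>K. qpoch (- (c * x)) q N / qpoch q q N * b ^ N * (q ^ K) ^ N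
          * (qpoch q q (K - N) * ?Q)) \<longlonglongrightarrow> qpoch (- (c * x)) q N / qpoch q q N * b ^ N * 0 ^ N * (?Q * ?Q)"
        by (intro tendsto_mult tendsto_const)
      moreover have "\<forall>\<^sub>F K in sequentially. qpoch (- (c * x)) q N / qpoch q q N * b ^ N * (q ^ K) ^ N
          * (qpoch q q (K - N) * ?Q) = t N K"
        using eventually_ge_at_top[of N] by (rule eventually_mono) (simp add: t_def)
      ultimately have "(\<lambda>K. t N K) \<longlonglongrightarrow> qpoch (- (c * x)) q N / qpoch q q N * b ^ N * 0 ^ N * (?Q * ?Q)"
        by (rule Lim_transform_eventually)
      then show ?thesis
        by (cases N) (auto simp: power2_eq_square)
    qed
    \<comment> \<open>No Gaussian factor uniform in \<open>K\<close> is left in \<open>t\<close>, so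
      the majorant is geometric and rests on b < 1.\<close>
    have bd: "norm (t N K) \<le> qpoch_inf (- (c * x)) q / ?Q * qpoch_inf (-1) q * ?Q * b ^ N" for N K
    proof (cases "N \<le> K")
      case True
      then have "norm (t N K) = \<bar>qpoch (- (c * x)) q N / qpoch q q N\<bar> * \<bar>qpoch q q (K - N)\<bar> * ?Q
          * b ^ N * (q ^ K) ^ N"
        using b q_pos by (simp add: t_def abs_mult less_imp_le)
      also have "\<dots> \<le> qpoch_inf (- (c * x)) q / ?Q * qpoch_inf (-1) q * ?Q * b ^ N * 1"
        using b q_pos q_less cx qpoch_inf_ge_1[OF cx] qpoch_inf_ge_1[of 1]
        by (intro mult_mono qpoch_quotient_bound abs_qpoch_le power_le_one)
          (auto intro!: mult_nonneg_nonneg divide_nonneg_pos simp: less_imp_le)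
      finally show ?thesis by simp
    next
      case False
      then show ?thesis
        using b qpoch_inf_ge_1[OF cx] qpoch_inf_ge_1[of 1]
        by (auto simp: t_def less_imp_le intro!: mult_nonneg_nonneg divide_nonneg_pos)
    qed
    have sm: "summable (\<lambda>N. b ^ N)" using b by (intro summable_geometric) simp
    have "\<forall>\<^sub>F (N, K) in sequentially \<times>\<^sub>F sequentially. norm (t N K)
        \<le> qpoch_inf (- (c * x)) q / ?Q * qpoch_inf (-1) q * ?Q * b ^ N"
      using bd by (intro always_eventually) blast
    from tannerys_theorem[OF lim this summable_mult[OF sm] trivial_limit_sequentially]
    show ?thesis by blast
  qed
  also have "(\<Sum>N. if N = 0 then ?Q\<^sup>2 else 0) = ?Q\<^sup>2"
    using sums_single[of 0 "\<lambda>_. ?Q\<^sup>2"] by (simp add: sums_iff)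
  finally have lim1: "(\<lambda>K. \<Sum>N. t N K) \<longlonglongrightarrow> ?Q\<^sup>2" .
  have "(\<lambda>K. q ^ (Suc K choose 2)) \<longlonglongrightarrow> 0"
  proof (rule tendsto_sandwich[of "\<lambda>_. 0"])
    show "\<forall>\<^sub>F K in sequentially. q ^ (Suc K choose 2) \<le> q ^ K"
      using q_pos q_less by (intro always_eventually allI power_decreasing) (auto simp: choose_two_Suc)
    show "(\<lambda>K. q ^ K) \<longlonglongrightarrow> 0"
      using q_pos q_less by (intro LIMSEQ_realpow_zero) auto
  qed (simp_all add: less_imp_le)
  then have xL: "(\<lambda>K. x * L * q ^ (Suc K choose 2)) \<longlonglongrightarrow> x * L * 0"
    by (intro tendsto_mult_left)
  have "(\<lambda>K. x * bes_deriv b (1 / (q ^ K * x)) x * ((-1) ^ K * q ^ (Suc K choose 2)) + (\<Sum>N. t N K)) \<longlonglongrightarrow> 0"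
  proof (rule Lim_null_comparison[rotated])
    show "(\<lambda>K. x * L * q ^ (Suc K choose 2)) \<longlonglongrightarrow> 0"
      using xL by simp
  qed (intro always_eventually allI, unfold real_norm_def, rule main)
  from tendsto_diff[OF this lim1] show ?thesis by simp
qed

end

section \<open>Telescoping the bilateral sum\<close>

lemma sum_telescope_int:
  fixes h :: "int \<Rightarrow> real"
  assumes "m \<le> n"
  shows "(\<Sum>p\<in>{m<..n}. h p - h (p - 1)) = h n - h m"
  using assms
proof (induction n rule: int_ge_induct)
  case (step n)
  then have "{m<..n + 1} = insert (n + 1) {m<..n}" by auto
  with step show ?case by simp
qed simp

lemma tendsto_at_bot_int:
  fixes h :: "int \<Rightarrow> real"
  assumes "(\<lambda>j. h (- (int j + m))) \<longlonglongrightarrow> L"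
  shows "(h \<longlongrightarrow> L) at_bot"
proof -
  have "filterlim (\<lambda>p. nat (- p - m)) sequentially at_bot"
    unfolding filterlim_at_top
  proof
    fix Z
    show "\<forall>\<^sub>F p in at_bot. Z \<le> nat (- p - m)"
      using eventually_le_at_bot[of "- int Z - m"] by (rule eventually_mono) linarith
  qed
  from filterlim_compose[OF assms this]
  have "((\<lambda>p. h (- (int (nat (- p - m)) + m))) \<longlongrightarrow> L) at_bot" .
  moreover have "\<forall>\<^sub>F p in at_bot. h (- (int (nat (- p - m)) + m)) = h p"
    using eventually_le_at_bot[of "- m"] by (rule eventually_mono) simp
  ultimately show ?thesis by (rule Lim_transform_eventually)
qed

lemma filterlim_neg_shift: "filterlim (\<lambda>j::nat. - (int j + m)) at_bot sequentially"
  unfolding filterlim_at_bot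
proof
  fix Z
  show "\<forall>\<^sub>F j in sequentially. - (int j + m) \<le> Z"
    using eventually_ge_at_top[of "nat (- Z - m)"] by (rule eventually_mono) linarith
qed

text \<open>The windows are half-open because \<open>sum_telescope_int\<close> evaluates sums over
  exactly such intervals.\<close>

lemma infsum_int_limit:
  fixes f :: "int \<Rightarrow> real"
  assumes "f summable_on UNIV"
  shows "(\<lambda>n. \<Sum>p\<in>{- int n<..int n}. f p) \<longlonglongrightarrow> infsum f UNIV"
proof -
  have "filterlim (\<lambda>n. {- int n<..int n}) (finite_subsets_at_top UNIV) sequentially"
    unfolding filterlim_finite_subsets_at_top
  proof safe
    fix X :: "int set" assume X: "finite X"
    define N where "N = Max ((\<lambda>p. nat \<bar>p\<bar> + 1) ` X)"
    have N: "nat \<bar>p\<bar> + 1 \<le> N" if "p \<in> X" for p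
      unfolding N_def using X that by (intro Max_ge) auto
    show "\<forall>\<^sub>F n in sequentially. finite {- int n<..int n} \<and> X \<subseteq> {- int n<..int n} \<and> {- int n<..int n} \<subseteq> UNIV"
      using eventually_ge_at_top[of N]
    proof (rule eventually_mono)
      fix n assume "N \<le> n"
      then have "- int n < p \<and> p \<le> int n" if "p \<in> X" for p
        using N[OF that] by linarith
      then show "finite {- int n<..int n} \<and> X \<subseteq> {- int n<..int n} \<and> {- int n<..int n} \<subseteq> UNIV"
        by auto
    qed
  qed
  then show ?thesis
  proof (rule filterlim_compose[rotated])
    show "(sum f \<longlongrightarrow> infsum f UNIV) (finite_subsets_at_top UNIV)"
      using has_sum_infsum[OF assms] by (simp add: has_sum_def)
  qed
qed

section \<open>The first-order system and its Casorati determinant\<close>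

locale q_bessel_pair = q_bessel +
  fixes b :: real
  assumes b_pos: "0 < b" and b_less: "b < 1"
begin

text \<open>\<open>b\<close> stands for \<open>q powr (\<alpha> + 1)\<close>, and \<open>fb p x\<close> is \<open>(b;q)\<^sub>\<infinity> 1\<phi>1(- c q powr (\<alpha> - p); b; q, x q powi (p + 1))\<close>;
  \<open>gb\<close> is \<open>fb\<close> with \<open>\<alpha> + 1\<close> in place of \<open>\<alpha>\<close>.\<close>

definition fb :: "int \<Rightarrow> real \<Rightarrow> real" where
  "fb p x = bes b (q powi (p + 1)) x"

definition gb :: "int \<Rightarrow> real \<Rightarrow> real" where
  "gb p x = bes (b * q) (q powi (p + 2)) x"

text \<open>As q^(p+2) / b = q powr (p + 1 - \<alpha>), this is the weight of the bilateral
  sum.\<close>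

definition rho :: "int \<Rightarrow> real" where
  "rho p = qpoch_inf (- (q powi (p + 2) / (b * c))) q / qpoch_inf (- (q powi (p + 1) / c)) q"

text \<open>The coefficient of \<open>gb p\<close> when \<open>bes_raise\<close> is divided by
  \<open>q\<close> and multiplied by \<open>rho p\<close>. By \<open>kappa_pred\<close> the
  coefficient of \<open>gb (p - 1)\<close> is the same sequence one index earlier, which is the
  symmetry of the recurrence.\<close>

definition kappa :: "int \<Rightarrow> real" where
  "kappa p = b / q * (c + q powi (p + 1)) * rho p"

text \<open>By \<open>fb_pred\<close>, x times \<open>gb p x\<close> is the difference of
  \<open>fb\<close> at p + 1 and p divided by q^(p+1), so this is a weighted Casorati determinant of
  \<open>fb\<close> at consecutive indices.\<close>

definition casorati :: "int \<Rightarrow> real \<Rightarrow> real \<Rightarrow> real" where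
  "casorati p x y = - kappa p * (x * gb p x * fb p y - y * gb p y * fb p x)"

text \<open>The derivative of the determinant in its first argument at equal arguments, where the
  determinant itself is 0.\<close>

definition casorati_diag :: "int \<Rightarrow> real \<Rightarrow> real" where
  "casorati_diag p x = - kappa p *
     ((gb p x + x * bes_deriv (b * q) (q powi (p + 2)) x) * fb p x
       - x * gb p x * bes_deriv b (q powi (p + 1)) x)"

definition summand :: "real \<Rightarrow> real \<Rightarrow> int \<Rightarrow> real" where
  "summand x y p = q powi p * rho p * fb p x * fb p y"

lemma abs_b_le: "\<bar>b\<bar> \<le> 1" "\<bar>b * q\<bar> \<le> 1"
  using b_pos b_less abs_mult_power_q_le[of b 1 1] by auto

lemma powi_Suc: "q powi (p + 1) = q powi p * q" "q powi (p + 2) = q powi p * q * q"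
  using power_int_add[of q p 2] by (simp_all add: power_int_add_1 power2_eq_square)

lemma powi_pos [simp]: "0 < q powi p"
  using q_pos by (simp add: zero_less_power_int)

lemma rho_pos: "0 < rho p"
  unfolding rho_def using b_pos c_pos
  by (intro divide_pos_pos qpoch_inf_neg_pos) (auto simp: less_imp_le)

text \<open>Going from p - 1 to p removes the first factor of each product in \<open>rho\<close>,
  and the quotient of these factors exchanges b (c + q^p) for b c + q^(p+1).\<close>

lemma kappa_pred: "kappa (p - 1) = rho p * (c * b / q + q powi p)"
proof -
  let ?u = "q powi p"
  define N M where "N = qpoch_inf (- (?u * q * q / (b * c))) q" and "M = qpoch_inf (- (?u * q / c)) q"
  have "0 < ?u" by simp
  then have pos: "0 < c + ?u" "0 < b * c + ?u * q" using c_pos q_pos b_pos by (auto intro!: add_pos_pos)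
  have "M > 0"
    unfolding M_def using c_pos q_pos by (intro qpoch_inf_neg_pos) (simp add: less_imp_le)
  have "qpoch_inf (- (?u * q / (b * c))) q = (1 + ?u * q / (b * c)) * N"
    unfolding N_def by (subst qpoch_inf_rec) (simp add: mult_ac)
  moreover have "qpoch_inf (- (?u / c)) q = (1 + ?u / c) * M"
    unfolding M_def by (subst qpoch_inf_rec) (simp add: mult_ac)
  moreover have "p - 1 + 2 = p + 1" "p - 1 + 1 = p" by simp_all
  ultimately have "kappa (p - 1) = b / q * (c + ?u) * ((1 + ?u * q / (b * c)) * N / ((1 + ?u / c) * M))"
    unfolding kappa_def rho_def by (simp only: powi_Suc)
  also have "\<dots> = N / M * (c * b / q + ?u)"
    using pos \<open>M > 0\<close> c_pos q_pos b_pos by (simp add: divide_simps)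
  finally show ?thesis
    by (simp add: rho_def powi_Suc N_def M_def)
qed

lemma gb_pred: "gb (p - 1) x = bes (b * q) (q powi p * q) x"
proof -
  have "p - 1 + 2 = p + 1" by simp
  then show ?thesis unfolding gb_def by (simp only: powi_Suc)
qed

lemma fb_pred: "fb (p - 1) x = fb p x - q powi p * x * gb (p - 1) x"
  using bes_shift[OF abs_b_le(1), of "q powi p" x]
  by (simp add: fb_def gb_pred powi_Suc)

lemma kappa_gb: "kappa p * gb p x = kappa (p - 1) * gb (p - 1) x - rho p * q powi p * fb p x"
proof -
  have "q powi p * fb p x * q = (q powi p * q + c * b) * gb (p - 1) x - b * (c + q powi p * q) * gb p x"
    using bes_raise[OF abs_b_le(1), of "q powi p * q" x]
    by (simp add: fb_def gb_pred) (simp add: gb_def powi_Suc mult_ac)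
  then have "q powi p * fb p x
      = ((q powi p * q + c * b) * gb (p - 1) x - b * (c + q powi p * q) * gb p x) / q"
    by (simp add: eq_divide_eq)
  also have "\<dots> = (q powi p + c * b / q) * gb (p - 1) x - b / q * (c + q powi p * q) * gb p x"
    by (simp add: divide_simps)
  finally have "q powi p * fb p x = (q powi p + c * b / q) * gb (p - 1) x - b / q * (c + q powi p * q) * gb p x" .
  then have "rho p * (q powi p * fb p x) = rho p * ((q powi p + c * b / q) * gb (p - 1) x - b / q * (c + q powi p * q) * gb p x)"
    by simp
  then show ?thesis
    unfolding kappa_pred kappa_def[of p] powi_Suc by (simp add: algebra_simps)
qed

text \<open>When everything is expressed by \<open>fb p\<close> and \<open>gb (p - 1)\<close>, the
  products of the two \<open>gb\<close> values cancel by antisymmetry and only the product of the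
  two \<open>fb\<close> values remains, with coefficient x - y.\<close>

lemma casorati_step: "casorati p x y - casorati (p - 1) x y = (x - y) * summand x y p"
proof -
  have "casorati p x y = - (x * (kappa p * gb p x) * fb p y - y * (kappa p * gb p y) * fb p x)"
    by (simp add: casorati_def algebra_simps)
  then show ?thesis
    unfolding casorati_def[of "p - 1"] fb_pred kappa_gb[of p x] kappa_gb[of p y] summand_def by (simp add: algebra_simps)
qed

lemma DERIV_casorati: "((\<lambda>x. casorati p x y) has_field_derivative casorati_diag p y) (at y)"
proof -
  have [derivative_intros]:
    "(fb p has_field_derivative bes_deriv b (q powi (p + 1)) y) (at y)"
    "(gb p has_field_derivative bes_deriv (b * q) (q powi (p + 2)) y) (at y)"
    unfolding fb_def[abs_def] gb_def[abs_def] by (intro DERIV_bes abs_b_le)+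
  show ?thesis
    unfolding casorati_def casorati_diag_def
    by (auto intro!: derivative_eq_intros simp: algebra_simps)
qed

text \<open>Differentiating \<open>casorati_step\<close> at equal arguments removes the factor x -
  y.\<close>

lemma casorati_diag_step: "casorati_diag p y - casorati_diag (p - 1) y = summand y y p"
proof -
  have "((\<lambda>x. casorati p x y - casorati (p - 1) x y) has_field_derivative
      casorati_diag p y - casorati_diag (p - 1) y) (at y)"
    by (intro DERIV_diff DERIV_casorati)
  moreover have "((\<lambda>x. (x - y) * summand x y p) has_field_derivative summand y y p) (at y)"
  proof -
    have [derivative_intros]: "(fb p has_field_derivative bes_deriv b (q powi (p + 1)) y) (at y)"
      unfolding fb_def[abs_def] by (intro DERIV_bes abs_b_le)
    show ?thesis
      unfolding summand_def by (auto intro!: derivative_eq_intros)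
  qed
  ultimately show ?thesis
    unfolding casorati_step by (rule DERIV_unique)
qed

section \<open>Boundary values for \<open>p\<close> tending to infinity\<close>

lemma powi_tendsto_0: "(\<lambda>n. q powi (int n + k)) \<longlonglongrightarrow> 0"
proof -
  have "(\<lambda>n. q ^ n * q powi k) \<longlonglongrightarrow> 0 * q powi k"
    using q_pos q_less by (intro tendsto_mult_right LIMSEQ_realpow_zero) auto
  then show ?thesis by (simp add: power_int_add)
qed

text \<open>The numerator of the q-Bessel kernel up to powers of \<open>c\<close> and
  \<open>q\<close> and the square of (q;q) infinity.\<close>

definition kernel_limit :: "real \<Rightarrow> real \<Rightarrow> real" where
  "kernel_limit x y = x * bes (b * q) 0 x * bes b 0 y - y * bes (b * q) 0 y * bes b 0 x"

definition kernel_diag :: "real \<Rightarrow> real" where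
  "kernel_diag x = (bes (b * q) 0 x + x * bes_deriv (b * q) 0 x) * bes b 0 x
     - x * bes (b * q) 0 x * bes_deriv b 0 x"

lemma DERIV_kernel: "((\<lambda>x. kernel_limit x y) has_field_derivative kernel_diag y) (at y)"
proof -
  have [derivative_intros]:
    "(bes b 0 has_field_derivative bes_deriv b 0 y) (at y)"
    "(bes (b * q) 0 has_field_derivative bes_deriv (b * q) 0 y) (at y)"
    by (intro DERIV_bes abs_b_le)+
  show ?thesis
    unfolding kernel_limit_def kernel_diag_def
    by (auto intro!: derivative_eq_intros simp: algebra_simps)
qed

lemma kappa_tendsto: "(\<lambda>n. kappa (int n)) \<longlonglongrightarrow> b * c / q"
proof -
  have "(\<lambda>n. kappa (int n)) \<longlonglongrightarrow> b / q * (c + 0) * (qpoch_inf (- (0 / (b * c))) q / qpoch_inf (- (0 / c)) q)"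
    unfolding kappa_def rho_def using b_pos c_pos
    by (intro tendsto_intros tendsto_qpoch_inf powi_tendsto_0) auto
  then show ?thesis by simp
qed

lemma casorati_tendsto: "(\<lambda>n. casorati (int n) x y) \<longlonglongrightarrow> - (b * c / q) * kernel_limit x y"
  unfolding casorati_def kernel_limit_def fb_def gb_def
  by (intro tendsto_intros kappa_tendsto tendsto_bes abs_b_le powi_tendsto_0)

lemma casorati_diag_tendsto: "(\<lambda>n. casorati_diag (int n) x) \<longlonglongrightarrow> - (b * c / q) * kernel_diag x"
  unfolding casorati_diag_def kernel_diag_def fb_def gb_def
  by (intro tendsto_intros kappa_tendsto tendsto_bes abs_b_le powi_tendsto_0)


section \<open>Boundary values for \<open>p\<close> tending to minus infinity\<close>

definition Theta :: real where
  "Theta = qpoch_inf (- (b * c / q)) q * qpoch_inf (- (q\<^sup>2 / (b * c))) q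
     / (qpoch_inf (- c) q * qpoch_inf (- (q / c)) q)"

lemma powi_neg_add: "q powi (- int n + m) = q powi m / q ^ n"
proof -
  have "q powi (- int n + m) = q powi (- int n) * q powi m"
    by (rule power_int_add) simp
  then show ?thesis
    by (simp only: power_int_minus power_int_of_nat divide_inverse mult.commute)
qed

text \<open>Inverting both products yields the same Gaussian power, which cancels. Hence (b / q)^n
  times the weight converges, with limit \<open>Theta\<close>.\<close>

lemma rho_neg:
  "rho (- int n) = (q / b) ^ n * (qpoch (- (b * c / q)) q n / qpoch (- c) q n)
     * (qpoch_inf (- (q\<^sup>2 / (b * c))) q / qpoch_inf (- (q / c)) q)"
proof -
  have p: "q powi (- int n + 2) = q\<^sup>2 / q ^ n" "q powi (- int n + 1) = q / q ^ n"
    by (simp_all only: powi_neg_add) auto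
  have 1: "qpoch_inf (- (q\<^sup>2 / (b * c)) / q ^ n) q = (q\<^sup>2 / (b * c)) ^ n / q ^ (Suc n choose 2)
      * qpoch (- (b * c / q)) q n * qpoch_inf (- (q\<^sup>2 / (b * c))) q"
    using qpoch_inf_shift_back[of "- (q\<^sup>2 / (b * c))" n] b_pos c_pos
    by (simp add: power2_eq_square)
  have 2: "qpoch_inf (- (q / c) / q ^ n) q = (q / c) ^ n / q ^ (Suc n choose 2)
      * qpoch (- c) q n * qpoch_inf (- (q / c)) q"
    using qpoch_inf_shift_back[of "- (q / c)" n] c_pos by simp
  have "(q\<^sup>2 / (b * c)) ^ n = (q / b) ^ n * (q / c) ^ n"
    by (simp add: power2_eq_square flip: power_mult_distrib)
  moreover have "(q / c) ^ n \<noteq> 0" using c_pos by simp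
  ultimately show ?thesis
    using 1 2 unfolding rho_def p by (simp add: mult_ac)
qed

text \<open>The factor c + q^(p+1) contributes a further q^(- n), so the rate (q / b)^n of the
  weight becomes b^(- n).\<close>

lemma kappa_at_bot: "((\<lambda>p. kappa p * b powi (- p)) \<longlongrightarrow> b * Theta) at_bot"
proof (rule tendsto_at_bot_int[of _ 0])
  have eq: "kappa (- (int n + 0)) * b powi (- (- (int n + 0))) = b / q * (c * q ^ n + q)
     * (qpoch (- (b * c / q)) q n / qpoch (- c) q n)
     * (qpoch_inf (- (q\<^sup>2 / (b * c))) q / qpoch_inf (- (q / c)) q)" for n
  proof -
    have p: "q powi (- int n + 1) = q / q ^ n"
      by (simp only: powi_neg_add power_int_1_right)
    have "(c + q / q ^ n) * (q / b) ^ n * b ^ n = c * q ^ n + q"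
      using b_pos by (simp add: power_divide field_simps)
    then show ?thesis
      unfolding kappa_def add_0_right minus_minus p rho_neg power_int_of_nat by (simp add: mult_ac)
  qed
  have ne: "qpoch_inf (- c) q \<noteq> 0"
    using c_pos qpoch_inf_neg_pos[of c] by simp
  have "(\<lambda>n. q ^ n) \<longlonglongrightarrow> 0"
    using q_pos q_less by (intro LIMSEQ_realpow_zero) auto
  then have "(\<lambda>n. b / q * (c * q ^ n + q)
     * (qpoch (- (b * c / q)) q n / qpoch (- c) q n)
     * (qpoch_inf (- (q\<^sup>2 / (b * c))) q / qpoch_inf (- (q / c)) q)) \<longlonglongrightarrow>
     b / q * (c * 0 + q) * (qpoch_inf (- (b * c / q)) q / qpoch_inf (- c) q)
     * (qpoch_inf (- (q\<^sup>2 / (b * c))) q / qpoch_inf (- (q / c)) q)"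
    by (intro tendsto_intros qpoch_tendsto) (use ne q_pos q_less in simp_all)
  then show "(\<lambda>n. kappa (- (int n + 0)) * b powi (- (- (int n + 0)))) \<longlonglongrightarrow> b * Theta"
    unfolding eq by (simp add: Theta_def mult_ac)
qed

context
  fixes k :: int
begin

private abbreviation (input) xk where "xk \<equiv> q powi k"
text \<open>The shift by 2 + k brings both parameters to the form 1 / (q^K x) of the asymptotics,
  with K = j + 1 for \<open>fb\<close> but K = j for \<open>gb\<close>. This offset decides which
  product survives on the diagonal.\<close>

private abbreviation (input) pk where "pk j \<equiv> - (int j + (2 + k))"

lemma powi_index: "q powi (pk j + 1) = 1 / (q ^ Suc j * xk)" "q powi (pk j + 2) = 1 / (q ^ j * xk)"
proof -
  have "pk j + 1 = - (int (Suc j) + k)" "pk j + 2 = - (int j + k)" by simp_all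
  then show "q powi (pk j + 1) = 1 / (q ^ Suc j * xk)" "q powi (pk j + 2) = 1 / (q ^ j * xk)"
    using power_int_add[of q "int (Suc j)" k] power_int_add[of q "int j" k]
    by (simp_all only: power_int_minus power_int_of_nat inverse_eq_divide) auto
qed

lemma bq_bounds: "0 < b * q" "b * q < 1"
  using b_pos b_less q_pos q_less mult_strict_mono[of b 1 q 1] by auto

lemma fb_asym: "(\<lambda>j. fb (pk j) xk / ((- b) ^ Suc (Suc j) * q ^ (Suc (Suc j) choose 2)))
    \<longlonglongrightarrow> qpoch_inf (- (c * xk)) q"
  unfolding fb_def powi_index
  using LIMSEQ_Suc[OF bes_asym[OF b_pos b_less powi_pos[of k]]] .

lemma gb_asym: "(\<lambda>j. gb (pk j) xk / ((- (b * q)) ^ Suc j * q ^ (Suc j choose 2)))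
    \<longlonglongrightarrow> qpoch_inf (- (c * xk)) q"
  unfolding gb_def powi_index by (rule bes_asym[OF bq_bounds powi_pos])

lemma fb_deriv_asym: "(\<lambda>j. xk * bes_deriv b (q powi (pk j + 1)) xk
      * ((-1) ^ Suc j * q ^ (Suc (Suc j) choose 2))) \<longlonglongrightarrow> - (qpoch_inf q q)\<^sup>2"
  unfolding powi_index
  using LIMSEQ_Suc[OF bes_deriv_asym[OF b_pos b_less powi_pos[of k]]] .

lemma gb_deriv_asym: "(\<lambda>j. xk * bes_deriv (b * q) (q powi (pk j + 2)) xk
      * ((-1) ^ j * q ^ (Suc j choose 2))) \<longlonglongrightarrow> - (qpoch_inf q q)\<^sup>2"
  unfolding powi_index by (rule bes_deriv_asym[OF bq_bounds powi_pos])

lemma b_powi_index: "b ^ Suc j * b powi (pk j) = b powi (-1 - k)"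
    "b ^ Suc (Suc j) * b powi (pk j) = b powi (- k)"
proof -
  have "b ^ n * b powi m = b powi (int n + m)" for n m
    using b_pos by (simp add: power_int_add)
  moreover have "int (Suc j) + pk j = -1 - k" "int (Suc (Suc j)) + pk j = - k" by simp_all
  ultimately show "b ^ Suc j * b powi (pk j) = b powi (-1 - k)"
    "b ^ Suc (Suc j) * b powi (pk j) = b powi (- k)" by presburger+
qed

lemma fb_at_bot: "((\<lambda>p. fb p xk) \<longlongrightarrow> 0) at_bot"
proof (rule tendsto_at_bot_int[of _ "2 + k"])
  let ?d = "\<lambda>j. (- b) ^ Suc (Suc j) * q ^ (Suc (Suc j) choose 2)"
  have "?d \<longlonglongrightarrow> 0"
  proof (rule Lim_null_comparison[of _ "\<lambda>j. b ^ j"])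
    show "(\<lambda>j. b ^ j) \<longlonglongrightarrow> 0"
      using b_pos b_less by (intro LIMSEQ_realpow_zero) auto
    show "\<forall>\<^sub>F j in sequentially. norm (?d j) \<le> b ^ j"
    proof (intro always_eventually allI)
      fix j
      have "norm (?d j) = b ^ Suc (Suc j) * q ^ (Suc (Suc j) choose 2)"
        using b_pos q_pos by (simp add: abs_mult power_abs)
      also have "\<dots> \<le> b ^ j * 1"
        using b_pos b_less q_pos by (intro mult_mono power_decreasing power_q_le) auto
      finally show "norm (?d j) \<le> b ^ j" by simp
    qed
  qed
  from tendsto_mult[OF fb_asym this] show "(\<lambda>j. fb (pk j) xk) \<longlonglongrightarrow> 0"
    using b_pos by simp
qed

text \<open>The growth rate b^p of \<open>kappa\<close> only uses up the powers of \<open>b\<close>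
  in the decay of \<open>gb\<close>; the Gaussian power of \<open>q\<close> remains and tends to
  0.\<close>

lemma gb_at_bot: "((\<lambda>p. gb p xk * b powi p) \<longlongrightarrow> 0) at_bot"
proof (rule tendsto_at_bot_int[of _ "2 + k"])
  let ?d = "\<lambda>j. (-1) ^ Suc j * (q ^ Suc j * q ^ (Suc j choose 2)) * b powi (-1 - k)"
  have "(\<lambda>j. (-1) ^ Suc j * (q ^ Suc j * q ^ (Suc j choose 2))) \<longlonglongrightarrow> 0"
  proof (rule Lim_null_comparison[of _ "\<lambda>j. q ^ j"])
    show "(\<lambda>j. q ^ j) \<longlonglongrightarrow> 0"
      using q_pos q_less by (intro LIMSEQ_realpow_zero) auto
    show "\<forall>\<^sub>F j in sequentially. norm ((-1) ^ Suc j * (q ^ Suc j * q ^ (Suc j choose 2))) \<le> q ^ j"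
    proof (intro always_eventually allI)
      fix j
      have "norm ((-1) ^ Suc j * (q ^ Suc j * q ^ (Suc j choose 2))) = q ^ Suc j * q ^ (Suc j choose 2)"
        using q_pos by (simp add: abs_mult power_abs)
      also have "\<dots> \<le> q ^ j * 1"
        using q_pos q_less by (intro mult_mono power_decreasing power_q_le) auto
      finally show "norm ((-1) ^ Suc j * (q ^ Suc j * q ^ (Suc j choose 2))) \<le> q ^ j" by simp
    qed
  qed
  then have "?d \<longlonglongrightarrow> 0"
    by (rule tendsto_mult_left_zero)
  from tendsto_mult[OF gb_asym this]
  have "(\<lambda>j. gb (pk j) xk / ((- (b * q)) ^ Suc j * q ^ (Suc j choose 2)) * ?d j) \<longlonglongrightarrow> 0"
    by simp
  moreover have "gb (pk j) xk / ((- (b * q)) ^ Suc j * q ^ (Suc j choose 2)) * ?d j = gb (pk j) xk * b powi (pk j)" for j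
  proof -
    have "(- (b * q)) ^ Suc j = (-1) ^ Suc j * (b ^ Suc j * q ^ Suc j)"
      unfolding power_minus[of "b * q"] power_mult_distrib ..
    moreover have "(-1::real) ^ Suc j \<noteq> 0" "b ^ Suc j \<noteq> 0" "q ^ Suc j \<noteq> 0" "q ^ (Suc j choose 2) \<noteq> 0"
      using b_pos by simp_all
    ultimately show ?thesis
      unfolding b_powi_index(1)[of j, symmetric]
      by (simp del: power_Suc)
  qed
  ultimately show "(\<lambda>j. gb (pk j) xk * b powi (pk j)) \<longlonglongrightarrow> 0"
    by simp
qed

end

text \<open>A factor b^(- p) is attached to \<open>kappa\<close> and b^p to \<open>gb\<close>, so
  that every factor has a finite limit.\<close>

lemma casorati_at_bot: "((\<lambda>p. casorati p (q powi k) (q powi l)) \<longlongrightarrow> 0) at_bot"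
proof -
  have "((\<lambda>p. - (kappa p * b powi (- p)) * (q powi k * (gb p (q powi k) * b powi p) * fb p (q powi l)
     - q powi l * (gb p (q powi l) * b powi p) * fb p (q powi k))) \<longlongrightarrow>
     - (b * Theta) * (q powi k * 0 * 0 - q powi l * 0 * 0)) at_bot"
    by (intro tendsto_intros kappa_at_bot gb_at_bot fb_at_bot)
  moreover have "- (kappa p * b powi (- p)) * (q powi k * (gb p (q powi k) * b powi p) * fb p (q powi l)
     - q powi l * (gb p (q powi l) * b powi p) * fb p (q powi k)) = casorati p (q powi k) (q powi l)" for p
  proof -
    have "b powi (- p) * b powi p = 1"
      using b_pos by (simp add: power_int_minus)
    then have "casorati p (q powi k) (q powi l) = casorati p (q powi k) (q powi l) * (b powi (- p) * b powi p)"
      by simp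
    also have "\<dots> = - (kappa p * b powi (- p)) * (q powi k * (gb p (q powi k) * b powi p) * fb p (q powi l)
     - q powi l * (gb p (q powi l) * b powi p) * fb p (q powi k))"
      by (simp add: casorati_def algebra_simps)
    finally show ?thesis by simp
  qed
  ultimately show ?thesis by simp
qed

text \<open>In \<open>gb\<close> times the derivative of \<open>fb\<close> the powers of
  \<open>q\<close> cancel exactly, and the powers of \<open>b\<close> combine with those of
  \<open>kappa\<close> to a constant. In \<open>fb\<close> times the derivative of \<open>gb\<close>
  a factor q^(j+1) is left over, and the product without derivatives vanishes as off the
  diagonal.\<close>

lemma casorati_diag_at_bot:
  "((\<lambda>p. casorati_diag p (q powi k)) \<longlongrightarrow>
     - (Theta * qpoch_inf (- (c * q powi k)) q * (qpoch_inf q q)\<^sup>2 * b powi (- k))) at_bot"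
proof (rule tendsto_at_bot_int[of _ "2 + k"])
  let ?x = "q powi k" and ?p = "\<lambda>j. - (int j + (2 + k))"
  let ?P = "qpoch_inf (- (c * q powi k)) q" and ?Q = "qpoch_inf q q"
  define A where "A j = gb (?p j) ?x / ((- (b * q)) ^ Suc j * q ^ (Suc j choose 2))" for j
  define B where "B j = fb (?p j) ?x / ((- b) ^ Suc (Suc j) * q ^ (Suc (Suc j) choose 2))" for j
  define A' where "A' j = ?x * bes_deriv (b * q) (q powi (?p j + 2)) ?x * ((-1) ^ j * q ^ (Suc j choose 2))" for j
  define B' where "B' j = ?x * bes_deriv b (q powi (?p j + 1)) ?x * ((-1) ^ Suc j * q ^ (Suc (Suc j) choose 2))" for j
  define C where "C j = kappa (?p j) * b powi (- ?p j)" for j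
  define G where "G j = gb (?p j) ?x * b powi (?p j)" for j
  have lims: "A \<longlonglongrightarrow> ?P" "B \<longlonglongrightarrow> ?P" "A' \<longlonglongrightarrow> - ?Q\<^sup>2" "B' \<longlonglongrightarrow> - ?Q\<^sup>2"
    unfolding A_def B_def A'_def B'_def by (rule gb_asym fb_asym gb_deriv_asym fb_deriv_asym)+
  have lims2: "C \<longlonglongrightarrow> b * Theta" "G \<longlonglongrightarrow> 0" "(\<lambda>j. fb (?p j) ?x) \<longlonglongrightarrow> 0"
    unfolding C_def G_def
    by (rule filterlim_compose[OF _ filterlim_neg_shift] kappa_at_bot gb_at_bot fb_at_bot)+
  have "(\<lambda>j. q ^ Suc j) \<longlonglongrightarrow> 0"
    using q_pos q_less by (intro LIMSEQ_Suc LIMSEQ_realpow_zero) auto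
  \<comment> \<open>The determinant is regrouped into rescaled factors with known limits;
    \<open>b powi (- k)\<close> and \<open>b powi (-1 - k)\<close> are the powers of
    \<open>b\<close> left after the rescaling.\<close>
  then have "(\<lambda>j. - C j * ((G j * fb (?p j) ?x + A' j * B j * (b powi (- k) * q ^ Suc j))
        - A j * B' j * b powi (-1 - k))) \<longlonglongrightarrow>
     - (b * Theta) * ((0 * 0 + (- ?Q\<^sup>2) * ?P * (b powi (- k) * 0)) - ?P * (- ?Q\<^sup>2) * b powi (-1 - k))"
    by (intro tendsto_intros lims lims2)
  also have "- (b * Theta) * ((0 * 0 + (- ?Q\<^sup>2) * ?P * (b powi (- k) * 0)) - ?P * (- ?Q\<^sup>2) * b powi (-1 - k))
     = - (Theta * ?P * ?Q\<^sup>2 * (b * b powi (-1 - k)))"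
    by (simp add: algebra_simps)
  also have "b * b powi (-1 - k) = b powi (- k)"
    using b_pos by (simp add: power_int_diff power_int_minus inverse_eq_divide)
  finally have "(\<lambda>j. - C j * ((G j * fb (?p j) ?x + A' j * B j * (b powi (- k) * q ^ Suc j))
        - A j * B' j * b powi (-1 - k))) \<longlonglongrightarrow> - (Theta * ?P * ?Q\<^sup>2 * b powi (- k))" .
  moreover have "- C j * ((G j * fb (?p j) ?x + A' j * B j * (b powi (- k) * q ^ Suc j))
        - A j * B' j * b powi (-1 - k)) = casorati_diag (?p j) ?x" for j
  proof -
    let ?w = "b powi (?p j)"
    define s where "s = (-1::real) ^ j"
    have s1: "(-1) ^ Suc j = - s" "(- (b * q)) ^ Suc j = - s * (b ^ Suc j * q ^ Suc j)"
      "(- b) ^ Suc (Suc j) = s * b ^ Suc (Suc j)"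
      by (simp_all add: s_def power_minus[of b] power_minus[of "b * q"] power_mult_distrib)
    have ch: "q ^ (Suc (Suc j) choose 2) = q ^ (Suc j choose 2) * q ^ Suc j"
      by (simp only: choose_two_Suc[of "Suc j"] power_add)
    have ne: "s \<noteq> 0" "b ^ Suc j \<noteq> 0" "b ^ Suc (Suc j) \<noteq> 0" "q ^ Suc j \<noteq> 0" "q ^ (Suc j choose 2) \<noteq> 0"
      using b_pos by (auto simp: s_def)
    have e1: "A' j * B j * (b powi (- k) * q ^ Suc j)
      = ?x * bes_deriv (b * q) (q powi (?p j + 2)) ?x * fb (?p j) ?x * ?w"
      using ne unfolding A'_def B_def s1 ch s_def[symmetric] b_powi_index(2)[of j k, symmetric]
      by (simp del: power_Suc)
    have e2: "A j * B' j * b powi (-1 - k)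
      = gb (?p j) ?x * (?x * bes_deriv b (q powi (?p j + 1)) ?x) * ?w"
      using ne unfolding A_def B'_def s1 ch b_powi_index(1)[of j k, symmetric]
      by (simp del: power_Suc)
    have uw: "b powi (- ?p j) * ?w = 1"
      using b_pos by (subst power_int_add[symmetric]) auto
    have alg: "- (K * u) * ((g * w * f + x * d1 * f * w) - g * (x * d2) * w)
      = - K * ((g + x * d1) * f - x * g * d2) * (u * w)" for K u g w f x d1 d2 :: real
      by (simp add: algebra_simps)
    show ?thesis
      unfolding C_def G_def e1 e2 casorati_diag_def alg uw by simp
  qed
  ultimately show "(\<lambda>j. casorati_diag (?p j) ?x) \<longlonglongrightarrow> - (Theta * ?P * ?Q\<^sup>2 * b powi (- k))"
    by simp
qed


section \<open>Convergence and value of the bilateral sum\<close>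

lemma summand_sums:
  "(x - y) * (\<Sum>p\<in>{- int n<..int n}. summand x y p) = casorati (int n) x y - casorati (- int n) x y"
  "(\<Sum>p\<in>{- int n<..int n}. summand x x p) = casorati_diag (int n) x - casorati_diag (- int n) x"
  using sum_telescope_int[of "- int n" "int n" "\<lambda>p. casorati p x y"]
    sum_telescope_int[of "- int n" "int n" "\<lambda>p. casorati_diag p x"]
  unfolding casorati_step casorati_diag_step sum_distrib_left by simp_all

lemma summand_diag_nonneg: "0 \<le> summand x x p"
proof -
  have "summand x x p = q powi p * rho p * (fb p x)\<^sup>2"
    by (simp add: summand_def power2_eq_square)
  then show ?thesis
    using mult_nonneg_nonneg[OF mult_nonneg_nonneg[OF less_imp_le[OF powi_pos] less_imp_le[OF rho_pos]]
        zero_le_power2] by simp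
qed

lemma summand_diag_tendsto:
  "(\<lambda>n. \<Sum>p\<in>{- int n<..int n}. summand (q powi k) (q powi k) p) \<longlonglongrightarrow>
     Theta * qpoch_inf (- (c * q powi k)) q * (qpoch_inf q q)\<^sup>2 * b powi (- k)
      - b * c / q * kernel_diag (q powi k)"
proof -
  have "filterlim (\<lambda>n. - int n) at_bot sequentially"
    using filterlim_neg_shift[of 0] by simp
  from tendsto_diff[OF casorati_diag_tendsto filterlim_compose[OF casorati_diag_at_bot this]]
  show ?thesis
    unfolding summand_sums by (simp add: algebra_simps)
qed

text \<open>Convergence over symmetric windows is weaker than summability; nonnegative terms close
  the gap, since every finite partial sum lies below the limit.\<close>

lemma summable_summand_diag: "summand (q powi k) (q powi k) summable_on UNIV"
proof (rule nonneg_bdd_above_summable_on)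
  let ?f = "summand (q powi k) (q powi k)" and ?S = "\<lambda>n. {- int n<..int n}"
  have inc: "incseq (\<lambda>n. sum ?f (?S n))"
    unfolding incseq_def by (auto intro!: sum_mono2 summand_diag_nonneg)
  obtain L where L: "(\<lambda>n. sum ?f (?S n)) \<longlonglongrightarrow> L"
    using summand_diag_tendsto by blast
  show "bdd_above (sum ?f ` {F. F \<subseteq> UNIV \<and> finite F})"
  proof (rule bdd_aboveI2)
    fix F :: "int set" assume "F \<in> {F. F \<subseteq> UNIV \<and> finite F}"
    then have F: "finite F" by simp
    define N where "N = Max ((\<lambda>p. nat \<bar>p\<bar> + 1) ` F)"
    have N: "nat \<bar>p\<bar> + 1 \<le> N" if "p \<in> F" for p
      unfolding N_def using F that by (intro Max_ge) auto
    have "F \<subseteq> ?S N"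
    proof
      fix p assume "p \<in> F"
      from N[OF this] show "p \<in> ?S N" by auto
    qed
    then have "sum ?f F \<le> sum ?f (?S N)"
      by (intro sum_mono2 summand_diag_nonneg) auto
    also have "\<dots> \<le> L" by (rule incseq_le[OF inc L])
    finally show "sum ?f F \<le> L" .
  qed
qed (rule summand_diag_nonneg)

text \<open>Dominated by the two diagonal summands through |u v| <= u^2 + v^2.\<close>

lemma summable_summand: "summand (q powi k) (q powi l) summable_on UNIV"
proof -
  let ?x = "q powi k" and ?y = "q powi l"
  let ?g = "\<lambda>p. summand ?x ?x p + summand ?y ?y p"
  have "norm (summand ?x ?y p) \<le> ?g p" for p
  proof -
    have "\<bar>fb p ?x * fb p ?y\<bar> \<le> fb p ?x * fb p ?x + fb p ?y * fb p ?y"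
      using sum_squares_ge_zero[of "fb p ?x - fb p ?y" 0] sum_squares_ge_zero[of "fb p ?x + fb p ?y" 0]
        sum_squares_ge_zero[of "fb p ?x" "fb p ?y"]
      by (simp add: abs_le_iff algebra_simps)
    then have "q powi p * rho p * \<bar>fb p ?x * fb p ?y\<bar>
        \<le> q powi p * rho p * (fb p ?x * fb p ?x + fb p ?y * fb p ?y)"
      using mult_pos_pos[OF powi_pos[of p] rho_pos[of p]] by (intro mult_left_mono) auto
    moreover have "norm (summand ?x ?y p) = q powi p * rho p * \<bar>fb p ?x * fb p ?y\<bar>"
      using rho_pos[of p] q_pos by (simp add: summand_def abs_mult)
    ultimately show ?thesis
      by (simp add: summand_def algebra_simps)
  qed
  then have "(\<lambda>p. norm (summand ?x ?y p)) summable_on UNIV"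
    by (intro Infinite_Sum.abs_summable_on_comparison_test'[OF summable_on_add[OF summable_summand_diag summable_summand_diag]])
  then show ?thesis
    by (rule abs_summable_summable)
qed

lemma infsum_summand_diag:
  "(\<Sum>\<^sub>\<infinity>p. summand (q powi k) (q powi k) p) =
     Theta * qpoch_inf (- (c * q powi k)) q * (qpoch_inf q q)\<^sup>2 * b powi (- k)
      - b * c / q * kernel_diag (q powi k)"
  using LIMSEQ_unique[OF infsum_int_limit[OF summable_summand] summand_diag_tendsto] .

lemma infsum_summand:
  "(q powi k - q powi l) * (\<Sum>\<^sub>\<infinity>p. summand (q powi k) (q powi l) p)
     = - (b * c / q) * kernel_limit (q powi k) (q powi l)"
proof -
  let ?x = "q powi k" and ?y = "q powi l"
  have "filterlim (\<lambda>n. - int n) at_bot sequentially"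
    using filterlim_neg_shift[of 0] by simp
  from tendsto_diff[OF casorati_tendsto filterlim_compose[OF casorati_at_bot this]]
  have "(\<lambda>n. (?x - ?y) * (\<Sum>p\<in>{- int n<..int n}. summand ?x ?y p)) \<longlonglongrightarrow> - (b * c / q) * kernel_limit ?x ?y"
    unfolding summand_sums by simp
  moreover have "(\<lambda>n. (?x - ?y) * (\<Sum>p\<in>{- int n<..int n}. summand ?x ?y p)) \<longlonglongrightarrow> (?x - ?y) * (\<Sum>\<^sub>\<infinity>p. summand ?x ?y p)"
    by (intro tendsto_mult_left infsum_int_limit summable_summand)
  ultimately show ?thesis
    using LIMSEQ_unique by blast
qed

section \<open>Identification with the 1phi1-series, the q-Bessel functions and the constant\<close>

lemma phi11_eq_bes:
  assumes "0 < v" "0 < \<beta>" "\<beta> < 1"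
  shows "qpoch_inf \<beta> q * phi11 (- (c * \<beta> / v)) \<beta> q (v * x) = bes \<beta> v x"
proof -
  have "qpoch (- (c * \<beta> / v)) q j / (qpoch \<beta> q j * qpoch q q j) * (-1) ^ j * q ^ (j * (j - 1) div 2) * (v * x) ^ j
     = bes_coeff \<beta> v j * x ^ j / qpoch_inf \<beta> q" for j
  proof -
    have "0 < qpoch \<beta> q j" "0 < qpoch_inf (\<beta> * q ^ j) q"
      using assms qpoch_pos[of \<beta> j] qpoch_inf_pos[of \<beta>] qpoch_inf_split[of \<beta> j]
      by (auto simp: zero_less_mult_iff)
    then show ?thesis
      using assms
      by (simp add: bes_coeff_def shifted_prod_eq_qpoch qpoch_inf_split[of \<beta> j] choose_two
          power_mult_distrib mult_ac)
  qed
  moreover have "(\<lambda>j. bes_coeff \<beta> v j * x ^ j / qpoch_inf \<beta> q) sums (bes \<beta> v x / qpoch_inf \<beta> q)"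
    using assms by (intro sums_divide bes_sums) auto
  ultimately have "phi11 (- (c * \<beta> / v)) \<beta> q (v * x) = bes \<beta> v x / qpoch_inf \<beta> q"
    unfolding phi11_def by (simp add: sums_iff)
  then show ?thesis
    using assms qpoch_inf_pos[of \<beta>] by simp
qed

lemma phi01_eq_bes:
  assumes "0 < \<beta>" "\<beta> < 1"
  shows "qpoch_inf \<beta> q * phi01 \<beta> q (- (\<beta> * c * x)) = bes \<beta> 0 x"
proof -
  have sp: "shifted_prod (c * \<beta>) 0 j = (c * \<beta>) ^ j * q ^ (j choose 2)" for j
    by (induction j) (simp_all add: shifted_prod_Suc choose_two_Suc power_add)
  have e: "q ^ (j * (j - 1)) = q ^ (j choose 2) * q ^ (j choose 2)" for j
  proof -
    have "j * (j - 1) = (j choose 2) + (j choose 2)"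
      using double_choose_two[of j] by simp
    then show ?thesis by (simp add: power_add)
  qed
  have "q ^ (j * (j - 1)) * (- (\<beta> * c * x)) ^ j / (qpoch \<beta> q j * qpoch q q j)
     = bes_coeff \<beta> 0 j * x ^ j / qpoch_inf \<beta> q" for j
  proof -
    have "0 < qpoch \<beta> q j" "0 < qpoch_inf (\<beta> * q ^ j) q"
      using assms qpoch_pos[of \<beta> j] qpoch_inf_pos[of \<beta>] qpoch_inf_split[of \<beta> j]
      by (auto simp: zero_less_mult_iff)
    moreover have "(- (\<beta> * c * x)) ^ j = (-1) ^ j * ((c * \<beta>) ^ j * x ^ j)"
      by (simp add: power_minus[of "\<beta> * c * x"] power_mult_distrib)
    ultimately show ?thesis
      unfolding e bes_coeff_def sp qpoch_inf_split[of \<beta> j] by (simp add: mult_ac)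
  qed
  moreover have "(\<lambda>j. bes_coeff \<beta> 0 j * x ^ j / qpoch_inf \<beta> q) sums (bes \<beta> 0 x / qpoch_inf \<beta> q)"
    using assms by (intro sums_divide bes_sums) auto
  ultimately have "phi01 \<beta> q (- (\<beta> * c * x)) = bes \<beta> 0 x / qpoch_inf \<beta> q"
    unfolding phi01_def by (simp add: sums_iff)
  then show ?thesis
    using assms qpoch_inf_pos[of \<beta>] by simp
qed

text \<open>The numerator is antisymmetric and vanishes on the diagonal, so the quotient is a
  difference quotient of it; this is the content of l'Hopital's rule here.\<close>

lemma kernel_limit_quotient: "((\<lambda>y. kernel_limit x y / (x - y)) \<longlongrightarrow> kernel_diag x) (at x)"
proof -
  have "((\<lambda>y. (kernel_limit y x - kernel_limit x x) / (y - x)) \<longlongrightarrow> kernel_diag x) (at x)"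
    using DERIV_kernel[of x] by (simp add: has_field_derivative_iff)
  moreover have "(kernel_limit y x - kernel_limit x x) / (y - x) = kernel_limit x y / (x - y)" for y
  proof -
    have "kernel_limit x x = 0" "kernel_limit y x = - kernel_limit x y"
      by (simp_all add: kernel_limit_def)
    then show ?thesis
      using minus_divide_divide[of "kernel_limit x y" "x - y"] by simp
  qed
  ultimately show ?thesis by simp
qed

text \<open>A factor moves between the numerator products, since 1 + b c / q is b c / q times 1 + q
  / (b c). The prefactor gained is the one that also multiplies the kernel.\<close>

lemma Theta_eq:
  "Theta = b * c / q * (qpoch_inf (- (c * b)) q * qpoch_inf (- (q / (b * c))) q
      / (qpoch_inf (- c) q * qpoch_inf (- (q / c)) q))"
proof -
  have "qpoch_inf (- (b * c / q)) q = (1 + b * c / q) * qpoch_inf (- (c * b)) q"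
    by (subst qpoch_inf_rec) (simp add: mult_ac)
  moreover have "qpoch_inf (- (q / (b * c))) q = (1 + q / (b * c)) * qpoch_inf (- (q\<^sup>2 / (b * c))) q"
    by (subst qpoch_inf_rec) (simp add: power2_eq_square)
  moreover have "1 + b * c / q = b * c / q * (1 + q / (b * c))"
    using b_pos c_pos by (simp add: field_simps)
  ultimately show ?thesis
    by (simp add: Theta_def)
qed

end

section \<open>The identity\<close>

lemma powr_int: "0 < x \<Longrightarrow> x powr real_of_int n = x powi n"
  by (simp add: powr_real_of_int')

text \<open>\<open>Lim\<close> and the infinite sum take default values where no limit exists. The
  first two conjuncts exclude this, so the equation speaks of genuine limits.\<close>

theorem corollary4p3:
  fixes q c \<alpha> :: real and k l :: int
  assumes "0 < q" and "q < 1" and "c > 0" and "\<alpha> > -1"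
  shows "(k = l \<longrightarrow>
            (\<exists>L. ((\<lambda>y. bessel_kernel q c \<alpha> (real_of_int k) y) \<longlongrightarrow> L) (at (real_of_int k))))
       \<and> (\<lambda>p. bilateral_summand q c \<alpha> k l p) summable_on UNIV
       \<and> of_bool (k = l) * (c * q powi (- k) * qpoch_inf (- (c * q powi k)) q
            * ((qpoch_inf (- (c * q powr (\<alpha> + 1))) q * qpoch_inf (- (q powr (- \<alpha>) / c)) q)
               / (qpoch_inf (- c) q * qpoch_inf (- (q / c)) q)))
         = bessel_term q c \<alpha> k l
           + q powr (\<alpha> * (real_of_int (k + l) / 2 - 1))
             * (\<Sum>\<^sub>\<infinity>p. bilateral_summand q c \<alpha> k l p)"
proof -
  define b where "b = q powr (\<alpha> + 1)"
  have b: "0 < b" "b < 1"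
    using assms powr_less_mono'[of q 0 "\<alpha> + 1"] by (auto simp: b_def)
  interpret q_bessel_pair q c b
    using assms b by unfold_locales auto
  let ?Q = "qpoch_inf q q" and ?x = "q powi k" and ?y = "q powi l"

  have bq: "q powr (\<alpha> + 1 + 1) = b * q"
    using assms powr_add[of q "\<alpha> + 1" 1] by (simp add: b_def)
  have b_q: "q powr \<alpha> = b / q"
    using assms by (simp add: b_def powr_add)

  have summand_eq: "bilateral_summand q c \<alpha> k l p = 1 / ?Q\<^sup>2 * summand ?x ?y p" for p
  proof -
    have "q powr (real_of_int p + 1 - \<alpha>) = q powr (real_of_int (p + 2) - (\<alpha> + 1))"
      by (simp add: algebra_simps)
    also have "\<dots> = q powi (p + 2) / b"
      using assms unfolding powr_diff b_def by (simp only: powr_int)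
    finally have rho: "rho p = qpoch_inf (- (q powr (real_of_int p + 1 - \<alpha>) / c)) q / qpoch_inf (- (q powi (p + 1) / c)) q"
      by (simp add: rho_def)
    have "q powr (\<alpha> - real_of_int p) = q powr (\<alpha> + 1 - real_of_int (p + 1))"
      by simp
    also have "\<dots> = b / q powi (p + 1)"
      using assms unfolding powr_diff b_def by (simp only: powr_int)
    finally have a: "c * q powr (\<alpha> - real_of_int p) = c * b / q powi (p + 1)"
      by simp
    have phi: "qpoch_inf b q * phi11 (- (c * q powr (\<alpha> - real_of_int p))) b q (q powi (m + p + 1)) = fb p (q powi m)" for m
    proof -
      have "q powi (m + p + 1) = q powi (p + 1) * q powi m"
        using power_int_add[of q "p + 1" m] by (simp add: add_ac)
      then show ?thesis
        unfolding a fb_def by (simp only: phi11_eq_bes[OF powi_pos b])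
    qed
    show ?thesis
      unfolding bilateral_summand_def b_def[symmetric] rho[symmetric] summand_def phi[symmetric]
      by (simp add: power2_eq_square)
  qed

  \<comment> \<open>Real \<open>s\<close> and \<open>t\<close> are needed because the diagonal limit
    runs through real indices.\<close>
  have kernel: "bessel_kernel q c \<alpha> s t = c * q powr (\<alpha> * (s + t) / 2) / ?Q\<^sup>2
      * (kernel_limit (q powr s) (q powr t) / (q powr s - q powr t))" for s t
  proof -
    have arg: "(2 * sqrt c * q powr (t / 2))\<^sup>2 / 4 = c * q powr t" for t
    proof -
      have "(q powr (t / 2))\<^sup>2 = q powr t"
        unfolding power2_eq_square powr_add[symmetric] by simp
      then show ?thesis using assms by (simp add: power_mult_distrib)
    qed
    have pw: "(2 * sqrt c * q powr (t / 2) / 2) powr a = c powr (a / 2) * q powr (a * t / 2)" for t a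
    proof -
      have "sqrt c = c powr (1 / 2)" using assms by (simp add: powr_half_sqrt)
      then have "2 * sqrt c * q powr (t / 2) / 2 = c powr (1 / 2) * q powr (t / 2)" by simp
      then show ?thesis by (simp add: powr_mult powr_powr mult.commute)
    qed
    have J0: "jackson_J2 \<alpha> (2 * sqrt c * q powr (t / 2)) q
        = 1 / ?Q * (c powr (\<alpha> / 2) * q powr (\<alpha> * t / 2)) * bes b 0 (q powr t)" for t
      using phi01_eq_bes[OF b, of "q powr t"] arg[of t]
      unfolding jackson_J2_def pw b_def[symmetric] by (simp add: mult_ac)
    have J1: "jackson_J2 (\<alpha> + 1) (2 * sqrt c * q powr (t / 2)) q
        = 1 / ?Q * (c powr ((\<alpha> + 1) / 2) * q powr ((\<alpha> + 1) * t / 2)) * bes (b * q) 0 (q powr t)" for t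
      using phi01_eq_bes[OF bq_bounds, of "q powr t"] arg[of t]
      unfolding jackson_J2_def pw bq by (simp add: mult_ac)
    have xp: "q powr (t / 2) * q powr ((\<alpha> + 1) * t / 2) = q powr t * q powr (\<alpha> * t / 2)" for t
      unfolding powr_add[symmetric] by (simp add: field_simps)
    \<comment> \<open>The power c^(1/2 - \<alpha>) in the kernel is what reduces the powers of
      \<open>c\<close> from the two Bessel functions to c itself.\<close>
    have cp: "c powr (1/2 - \<alpha>) * c powr ((\<alpha> + 1) / 2) * c powr (\<alpha> / 2) = c"
    proof -
      have "1/2 - \<alpha> + (\<alpha> + 1) / 2 + \<alpha> / 2 = 1" by (simp add: field_simps)
      then show ?thesis unfolding powr_add[symmetric] using assms by simp
    qed
    have prod: "q powr (s / 2) * jackson_J2 (\<alpha> + 1) (2 * sqrt c * q powr (s / 2)) q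
          * jackson_J2 \<alpha> (2 * sqrt c * q powr (t / 2)) q
        = c powr ((\<alpha> + 1) / 2) * c powr (\<alpha> / 2) * q powr (\<alpha> * (s + t) / 2) / ?Q\<^sup>2
          * (q powr s * bes (b * q) 0 (q powr s) * bes b 0 (q powr t))" for s t
    proof -
      have st: "q powr (\<alpha> * s / 2) * q powr (\<alpha> * t / 2) = q powr (\<alpha> * (s + t) / 2)"
        unfolding powr_add[symmetric] by (simp add: field_simps)
      have "q powr (s / 2) * jackson_J2 (\<alpha> + 1) (2 * sqrt c * q powr (s / 2)) q
          * jackson_J2 \<alpha> (2 * sqrt c * q powr (t / 2)) q
        = c powr ((\<alpha> + 1) / 2) * c powr (\<alpha> / 2)
          * (q powr (s / 2) * q powr ((\<alpha> + 1) * s / 2)) * q powr (\<alpha> * t / 2) / ?Q\<^sup>2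
          * (bes (b * q) 0 (q powr s) * bes b 0 (q powr t))"
        unfolding J0 J1 by (simp add: power2_eq_square)
      then show ?thesis
        unfolding xp st[symmetric] by (simp add: mult_ac)
    qed
    have "bessel_kernel q c \<alpha> s t = (c powr (1/2 - \<alpha>) * c powr ((\<alpha> + 1) / 2) * c powr (\<alpha> / 2))
        * q powr (\<alpha> * (s + t) / 2) / ?Q\<^sup>2
        * (kernel_limit (q powr s) (q powr t) / (q powr s - q powr t))"
      unfolding bessel_kernel_def prod kernel_limit_def add.commute[of t s]
      by (simp add: algebra_simps diff_divide_distrib)
    then show ?thesis unfolding cp .
  qed

  have x: "q powr real_of_int m = q powi m" for m
    using assms by (simp add: powr_int)

  define L where "L = c * q powr (\<alpha> * k) / ?Q\<^sup>2 * kernel_diag ?x"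
  have lim: "((\<lambda>y. bessel_kernel q c \<alpha> (real_of_int k) y) \<longlongrightarrow> L) (at (real_of_int k))"
  proof -
    have "((\<lambda>y. q powr y) \<longlongrightarrow> ?x) (at (real_of_int k))"
      unfolding x[symmetric] by (intro tendsto_intros) (use assms in auto)
    moreover have "\<forall>\<^sub>F y in at (real_of_int k). q powr y \<noteq> ?x"
      unfolding eventually_at_filter x[symmetric]
      using assms by (intro always_eventually) (auto simp: powr_def)
    ultimately have "filterlim (\<lambda>y. q powr y) (at ?x) (at (real_of_int k))"
      by (simp add: filterlim_at)
    from filterlim_compose[OF kernel_limit_quotient this]
    have "((\<lambda>y. c * q powr (\<alpha> * (real_of_int k + y) / 2) / ?Q\<^sup>2
        * (kernel_limit ?x (q powr y) / (?x - q powr y))) \<longlongrightarrow>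
        c * q powr (\<alpha> * (real_of_int k + real_of_int k) / 2) / ?Q\<^sup>2 * kernel_diag ?x) (at (real_of_int k))"
      by (intro tendsto_intros) (use assms in auto)
    then show ?thesis
      unfolding kernel x L_def by simp
  qed

  have sm: "(\<lambda>p. bilateral_summand q c \<alpha> k l p) summable_on UNIV"
    unfolding summand_eq by (intro summable_on_cmult_right summable_summand)
  have inf: "(\<Sum>\<^sub>\<infinity>p. bilateral_summand q c \<alpha> k l p) = 1 / ?Q\<^sup>2 * (\<Sum>\<^sub>\<infinity>p. summand ?x ?y p)"
    unfolding summand_eq by (rule infsum_cmult_right) (rule summable_summand)

  \<comment> \<open>Since b / q = q powr \<alpha>, the prefactor of the sum turns the coefficient b
    c / q of the boundary term into that of the Bessel kernel.\<close>
  have bm: "b * c / q * q powr (\<alpha> * (real_of_int (k + l) / 2 - 1)) = c * q powr (\<alpha> * (real_of_int k + real_of_int l) / 2)"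
  proof -
    have "q powr \<alpha> * q powr (\<alpha> * (real_of_int (k + l) / 2 - 1)) = q powr (\<alpha> * (real_of_int k + real_of_int l) / 2)"
      unfolding powr_add[symmetric] by (simp add: algebra_simps)
    then show ?thesis unfolding b_q by (simp add: field_simps)
  qed

  have "of_bool (k = l) * (c * q powi (- k) * qpoch_inf (- (c * q powi k)) q
            * ((qpoch_inf (- (c * q powr (\<alpha> + 1))) q * qpoch_inf (- (q powr (- \<alpha>) / c)) q)
               / (qpoch_inf (- c) q * qpoch_inf (- (q / c)) q)))
         = bessel_term q c \<alpha> k l
           + q powr (\<alpha> * (real_of_int (k + l) / 2 - 1))
             * (\<Sum>\<^sub>\<infinity>p. bilateral_summand q c \<alpha> k l p)"
  proof (cases "k = l")
    case False
    then have ne: "?x - ?y \<noteq> 0"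
      using assms powr_inj[of q "real_of_int k" "real_of_int l"] by (simp add: x)
    have "(\<Sum>\<^sub>\<infinity>p. summand ?x ?y p) = - (b * c / q) * kernel_limit ?x ?y / (?x - ?y)"
      using infsum_summand[of k l] ne by (simp add: field_simps)
    then have "q powr (\<alpha> * (real_of_int (k + l) / 2 - 1)) * (\<Sum>\<^sub>\<infinity>p. bilateral_summand q c \<alpha> k l p)
       = - (b * c / q * q powr (\<alpha> * (real_of_int (k + l) / 2 - 1))) / ?Q\<^sup>2 * (kernel_limit ?x ?y / (?x - ?y))"
      unfolding inf by (simp add: mult_ac)
    also have "\<dots> = - bessel_kernel q c \<alpha> (real_of_int k) (real_of_int l)"
      unfolding bm kernel x by simp
    finally show ?thesis
      using False by (simp add: bessel_term_def)
  next
    case True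
    let ?P = "qpoch_inf (- (c * ?x)) q"
    let ?M = "qpoch_inf (- (c * b)) q * qpoch_inf (- (q / (b * c))) q / (qpoch_inf (- c) q * qpoch_inf (- (q / c)) q)"
    have lim_eq: "bessel_term q c \<alpha> k l = L"
      using True lim by (simp add: bessel_term_def tendsto_Lim)
    have "(\<Sum>\<^sub>\<infinity>p. bilateral_summand q c \<alpha> k l p)
      = 1 / ?Q\<^sup>2 * (b * c / q * ?M * ?P * ?Q\<^sup>2 * b powi (- k) - b * c / q * kernel_diag ?x)"
      using inf infsum_summand_diag[of k] True by (simp only: Theta_eq)
    moreover have "E * (1 / ?Q\<^sup>2 * (B * M * P * ?Q\<^sup>2 * w - B * d))
      = B * E * w * P * M - B * E / ?Q\<^sup>2 * d" for E B M P w d :: real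
      by (simp add: field_simps)
    ultimately have "q powr (\<alpha> * (real_of_int (k + l) / 2 - 1)) * (\<Sum>\<^sub>\<infinity>p. bilateral_summand q c \<alpha> k l p)
      = (b * c / q * q powr (\<alpha> * (real_of_int (k + l) / 2 - 1))) * b powi (- k) * ?P * ?M
        - (b * c / q * q powr (\<alpha> * (real_of_int (k + l) / 2 - 1))) / ?Q\<^sup>2 * kernel_diag ?x"
      by (simp only:)
    also have "\<dots> = c * (q powr (\<alpha> * k) * b powi (- k)) * ?P * ?M - L"
      unfolding bm L_def using True by (simp add: algebra_simps)
    also have "q powr (\<alpha> * k) * b powi (- k) = q powi (- k)"
    proof -
      have "b powi (- k) = q powr ((\<alpha> + 1) * real_of_int (- k))"
        using b by (simp add: b_def powr_powr flip: powr_int)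
      then have "q powr (\<alpha> * k) * b powi (- k) = q powr real_of_int (- k)"
        by (simp only: powr_add[symmetric]) (simp add: algebra_simps)
      then show ?thesis unfolding x .
    qed
    finally have main: "c * q powi (- k) * ?P * ?M
      = L + q powr (\<alpha> * (real_of_int (k + l) / 2 - 1)) * (\<Sum>\<^sub>\<infinity>p. bilateral_summand q c \<alpha> k l p)"
      by simp
    have "q powr (- \<alpha>) / c = q / (b * c)"
      using assms b_q by (simp add: powr_minus inverse_eq_divide)
    then show ?thesis
      unfolding lim_eq b_def[symmetric] using True main by simp
  qed
  then show ?thesis
    using lim sm by blast
qed

end
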